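(* Let $\beta\ge-1/2$. Then there exists a constant $C=C(\beta)$ such that for all $t\ge0$, all $\alpha>\max(\beta,0)$, and all $\lambda\in\mathbb R$, $$\Bigl|\varphi_{i\rho-\lambda}^{(\alpha,\beta)}(t)-e^{i\lambda\ln(\cosh t)}\Bigr|\le C\,\frac{|\lambda|\min(1,t)}{\alpha^{1/2}},$$ where $\rho:=\alpha+\beta+1$.
   Context: The Jacobi functions are $$\varphi_\mu^{(\alpha,\beta)}(t):={}_2F_1\bigl((\alpha+\beta+1-i\mu)/2,(\alpha+\beta+1+i\mu)/2;\alpha+1;-\sinh^2t\bigr)\qquad(\mu\in\mathbb C,\ t\ge0),$$ where ${}_2F_1$ is the Gauss hypergeometric function (analytically continued to $\mathbb C\setminus[1,\infty[$). *)

theory Defs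
  imports "HOL-Complex_Analysis.Complex_Analysis"
begin

definition slit_plane :: "complex set" where
  "slit_plane = - (complex_of_real ` {1..})"

definition hyp2f1_continuation :: "complex \<Rightarrow> complex \<Rightarrow> complex \<Rightarrow> (complex \<Rightarrow> complex) \<Rightarrow> bool" where
  "hyp2f1_continuation a b c F \<longleftrightarrow>
     F holomorphic_on slit_plane \<and>
     (\<forall>z\<in>ball 0 1. F z = eval_fps (fps_hypergeo [a, b] [c] 1) z)"

(* Meaningful for c not in {0, -1, -2, ...} and z in the slit plane; unspecified elsewhere. *)
definition hyp2f1 :: "complex \<Rightarrow> complex \<Rightarrow> complex \<Rightarrow> complex \<Rightarrow> complex" where
  "hyp2f1 a b c z = (THE w. \<exists>F. hyp2f1_continuation a b c F \<and> w = F z)"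

definition jacobi_fun :: "real \<Rightarrow> real \<Rightarrow> complex \<Rightarrow> real \<Rightarrow> complex" where
  "jacobi_fun \<alpha> \<beta> \<mu> t =
     hyp2f1 ((of_real (\<alpha> + \<beta> + 1) - \<i> * \<mu>) / 2) ((of_real (\<alpha> + \<beta> + 1) + \<i> * \<mu>) / 2)
       (of_real (\<alpha> + 1)) (of_real (- ((sinh t)\<^sup>2)))"

lemma eval_fps_hypergeo_2F1:
  fixes a b c z :: complex
  shows "eval_fps (fps_hypergeo [a, b] [c] 1) z =
    (\<Sum>n. pochhammer a n * pochhammer b n / (pochhammer c n * fact n) * z ^ n)"
  by (simp add: eval_fps_def)

lemma open_slit_plane: "open slit_plane"
proof -
  have "complex_of_real ` {1..} = \<real> \<inter> {z. Re z \<ge> 1}"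
    by (auto simp: Reals_def)
  then have "closed (complex_of_real ` {1..})"
    by (simp add: closed_Int closed_complex_Reals closed_halfspace_Re_ge)
  then show ?thesis by (simp add: slit_plane_def open_Compl)
qed

lemma connected_slit_plane: "connected slit_plane"
proof (rule starlike_imp_connected)
  have "u *\<^sub>R z \<in> slit_plane" if z: "z \<in> slit_plane" and u: "0 \<le> u" "u \<le> 1" for z u
  proof (rule ccontr)
    assume "u *\<^sub>R z \<notin> slit_plane"
    then obtain x where x: "x \<ge> 1" "u *\<^sub>R z = of_real x"
      by (auto simp: slit_plane_def)
    have "u > 0" using x u by (cases "u = 0") auto
    then have "z = of_real (x / u)"
      using x(2) by (simp add: scaleR_conv_of_real field_simps)
    moreover have "x / u \<ge> 1" using x(1) \<open>u > 0\<close> u by simp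
    ultimately show False using z unfolding slit_plane_def by blast
  qed
  moreover have "0 \<in> slit_plane"
    by (auto simp: slit_plane_def)
  ultimately show "starlike slit_plane"
    unfolding starlike_def by (intro bexI[of _ 0]) (auto simp: in_segment)
qed

lemma hyp2f1_eqI:
  assumes F: "hyp2f1_continuation a b c F" and z: "z \<in> slit_plane"
  shows "hyp2f1 a b c z = F z"
proof -
  have sub: "ball 0 1 \<subseteq> slit_plane"
    by (auto simp: slit_plane_def)
  have "G z = F z" if G: "hyp2f1_continuation a b c G" for G
  proof (rule analytic_continuation_open[of "ball 0 1" slit_plane G F])
    show "G holomorphic_on slit_plane" "F holomorphic_on slit_plane"
      using F G by (simp_all only: hyp2f1_continuation_def)
    show "G w = F w" if "w \<in> ball 0 1" for w
      using F G that by (simp only: hyp2f1_continuation_def)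
  qed (simp_all add: sub z open_slit_plane connected_slit_plane)
  then show ?thesis
    unfolding hyp2f1_def using F by (intro the_equality) blast+
qed

end

theory Submission
  imports Defs
begin

text \<open>
  For \<open>\<mu> = \<i> \<rho> - l\<close> the Jacobi function is a hypergeometric function with parameters
  \<open>\<rho> + \<i> l / 2\<close>, \<open>- \<i> l / 2\<close>, \<open>\<alpha> + 1\<close> at \<open>- sinh\<^sup>2 t\<close>. If the first parameter were equal to
  the third, it would be the power \<open>(1 + sinh\<^sup>2 t)\<^bsup>\<i> l / 2\<^esup> = exp (\<i> l ln (cosh t))\<close>; the two
  parameters differ by \<open>\<beta> + \<i> l / 2\<close>, which is small relative to them when \<open>\<alpha>\<close> is large. Divide by this oscillation and call the quotient \<open>h\<close>; the claim
  is that \<open>h\<close> stays near its initial value \<open>1\<close>. It satisfies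
    \<open>h'' + ((2 \<alpha> + 1) coth t + (2 \<beta> + 1 + 2 \<i> l) tanh t) h' + (l\<^sup>2 - 2 \<i> l \<beta>) / cosh\<^sup>2 t h = 0\<close>,
  and the proof is an energy argument for this equation, with \<open>u = h' cosh\<close> as second unknown.

  First, \<open>h\<close> is bounded uniformly in \<open>l\<close> and \<open>t\<close> (\<open>uniform_bound\<close>). The energy
  \<open>\<bar>u\<bar>\<^sup>2 + l\<^sup>2 \<bar>h\<bar>\<^sup>2\<close> would decrease if \<open>\<beta>\<close> were \<open>0\<close>: the imaginary part of the first order
  coefficient does no work and the real part is damping. For other \<open>\<beta>\<close> the imaginary part of the
  potential can feed energy in, but the damping absorbs this except for a factor that is bounded
  in terms of \<open>\<beta>\<close> when \<open>\<alpha>\<close> stays away from \<open>0\<close>, and blows up slowly when \<open>\<alpha>\<close> tends to \<open>0\<close>.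
  Second, \<open>h\<close> moves slowly (\<open>derivative_bound\<close>): with \<open>\<bar>h\<bar> \<le> K\<close>, the potential is a source term
  of size at most \<open>(l\<^sup>2 + 2 \<bar>l \<beta>\<bar>) K\<close>, and the damping of strength \<open>2 \<alpha> + 1\<close> divides
  the response by that strength. Integrating gives a deviation of order
  \<open>(l\<^sup>2 + \<bar>l\<bar>) K (min 1 t)\<^sup>2 / (1 + 2 \<alpha>)\<close>. This is quadratic in \<open>l\<close>, but where it exceeds the
  desired linear bound the plain boundedness of \<open>h\<close> suffices; so the smaller of the two bounds
  is linear (\<open>deviation_estimate\<close>).

  The Jacobi function is defined through the analytic continuation of the hypergeometric series
  to the slit plane, so the existence of the continuation has to be shown as well
  (\<open>hyp2f1_continuation_exists\<close>). Euler's integral provides it after the parameters have been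
  raised by \<open>2\<close>, and two primitives on the starlike slit plane bring them back. The hypergeometric
  equation extends from the unit disc by the identity theorem, and along the negative real axis
  it turns into the equation above (\<open>jacobi_fun_modulated\<close>).
\<close>

section \<open>The slit plane and the hypergeometric series\<close>

lemma slit_plane_iff: "z \<in> slit_plane \<longleftrightarrow> 1 - z \<notin> \<real>\<^sub>\<le>\<^sub>0"
proof -
  have "z \<in> complex_of_real ` {1..} \<longleftrightarrow> Im z = 0 \<and> Re z \<ge> 1"
    by (auto simp: complex_eq_iff image_iff intro!: exI[of _ "Re z"] bexI[of _ "Re z"])
  then show ?thesis
    by (auto simp: slit_plane_def complex_nonpos_Reals_iff)
qed

lemma slit_plane_scale:
  assumes "z \<in> slit_plane" "0 \<le> u" "u \<le> 1"
  shows "z * of_real u \<in> slit_plane"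
proof (rule ccontr)
  assume "z * of_real u \<notin> slit_plane"
  then have "Re z * u \<ge> 1" "Im z * u = 0"
    by (auto simp: slit_plane_iff complex_nonpos_Reals_iff)
  then have "Im z = 0" "Re z * u \<ge> 1" by auto
  moreover have "Re z \<ge> 1"
  proof -
    have "Re z \<ge> 0" using \<open>Re z * u \<ge> 1\<close> assms(2)
      by (metis mult.commute mult_nonneg_nonpos nle_le order.trans zero_le_one not_one_le_zero)
    then have "Re z * u \<le> Re z * 1" using assms by (intro mult_left_mono) auto
    then show ?thesis using \<open>Re z * u \<ge> 1\<close> by simp
  qed
  ultimately show False
    using assms(1) by (simp add: slit_plane_iff complex_nonpos_Reals_iff)
qed

lemma starlike_slit_plane: "starlike slit_plane"
  unfolding starlike_def
proof (intro bexI ballI subsetI)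
  fix z w assume "z \<in> slit_plane" "w \<in> closed_segment 0 z"
  then obtain u where "0 \<le> u" "u \<le> 1" "w = z * of_real u"
    by (auto simp: in_segment scaleR_conv_of_real mult.commute)
  then show "w \<in> slit_plane" using \<open>z \<in> slit_plane\<close> slit_plane_scale by simp
qed (simp add: slit_plane_iff complex_nonpos_Reals_iff)

lemma Re_pos_imp_not_nonpos_Int:
  assumes "Re w > 0"
  shows "w \<notin> \<int>\<^sub>\<le>\<^sub>0"
  using assms by (auto elim!: nonpos_Ints_cases)

lemma add_of_nat_nonzero:
  fixes c :: complex
  assumes "c \<notin> \<int>\<^sub>\<le>\<^sub>0"
  shows "c + of_nat n \<noteq> 0"
  using assms by (metis add_eq_0_iff2 minus_of_nat_in_nonpos_Ints)

lemma one_add_of_nat_nonzero: "1 + complex_of_nat n \<noteq> 0"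
  using of_nat_eq_0_iff[of "Suc n", where 'a = complex] by (simp only: of_nat_Suc)

lemma fps_conv_radius_2F1:
  fixes a b c :: complex
  assumes c: "c \<notin> \<int>\<^sub>\<le>\<^sub>0"
  shows "fps_conv_radius (fps_hypergeo [a, b] [c] 1) \<ge> 1"
  unfolding fps_conv_radius_def
proof (rule conv_radius_geI_ex)
  fix r :: real assume r: "0 < r" "ereal r < 1"
  define f where "f n = fps_nth (fps_hypergeo [a, b] [c] 1) n * complex_of_real r ^ n" for n
  define q where "q n = (a + of_nat n) * (b + of_nat n) / ((c + of_nat n) * (1 + of_nat n))" for n
  have lin: "(\<lambda>n. (a + of_nat n) / (c + of_nat n)) \<longlonglongrightarrow> 1" for a c :: complex
  proof -
    have "(\<lambda>n. (a / of_nat n + 1) / (c / of_nat n + 1)) \<longlonglongrightarrow> (0 + 1) / (0 + 1)"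
      by (intro tendsto_intros tendsto_divide_0 tendsto_of_nat) auto
    moreover have "\<forall>\<^sub>F n in sequentially. (a / of_nat n + 1) / (c / of_nat n + 1) = (a + of_nat n) / (c + of_nat n)"
      using eventually_gt_at_top[of 0]
    proof eventually_elim
      case (elim n)
      then have "x / of_nat n + 1 = (x + of_nat n) / of_nat n" for x :: complex
        by (simp add: add_divide_distrib)
      then show ?case using elim by simp
    qed
    ultimately show ?thesis
      by (simp add: tendsto_cong)
  qed
  have "(\<lambda>n. norm (q n) * r) \<longlonglongrightarrow> norm (1 * 1 :: complex) * r"
    unfolding q_def times_divide_times_eq[symmetric] by (intro tendsto_intros lin)
  moreover obtain s where s: "r < s" "s < 1" using r dense by auto
  ultimately have "\<forall>\<^sub>F n in sequentially. norm (q n) * r < s"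
    by (intro order_tendstoD(2)) auto
  then obtain N where N: "\<And>n. n \<ge> N \<Longrightarrow> norm (q n) * r < s"
    by (auto simp: eventually_sequentially)
  have "summable f"
  proof (rule summable_ratio_test[OF s(2)])
    fix n assume "n \<ge> N"
    have "fps_nth (fps_hypergeo [a, b] [c] 1) (Suc n) = q n * fps_nth (fps_hypergeo [a, b] [c] 1) n"
      unfolding fps_hypergeo_rec q_def by (simp add: mult.commute)
    then have "f (Suc n) = q n * of_real r * f n"
      unfolding f_def by simp
    then have "norm (f (Suc n)) = norm (q n) * r * norm (f n)"
      using r by (simp add: norm_mult)
    also have "\<dots> \<le> s * norm (f n)"
      using N[OF \<open>n \<ge> N\<close>] by (intro mult_right_mono) auto
    finally show "norm (f (Suc n)) \<le> s * norm (f n)" .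
  qed
  then show "\<exists>z. norm z = r \<and> summable (\<lambda>n. fps_nth (fps_hypergeo [a, b] [c] 1) n * z ^ n)"
    using r by (intro exI[of _ "of_real r"]) (simp add: f_def[abs_def])
qed

lemma fps_deriv_2F1:
  fixes a b c :: complex
  assumes c: "c \<notin> \<int>\<^sub>\<le>\<^sub>0"
  shows "fps_deriv (fps_hypergeo [a, b] [c] 1)
    = fps_const (a * b / c) * fps_hypergeo [a + 1, b + 1] [c + 1] 1"
proof (rule fps_ext)
  fix n
  have "pochhammer c (Suc n) \<noteq> 0"
    using c by (auto simp: pochhammer_eq_0_iff)
  then have "c \<noteq> 0" "pochhammer (c + 1) n \<noteq> 0"
    by (auto simp: pochhammer_rec)
  moreover have fact: "fact (Suc n) = (1 + of_nat n) * (fact n :: complex)"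
    by (simp add: algebra_simps)
  ultimately show "fps_nth (fps_deriv (fps_hypergeo [a, b] [c] 1)) n
    = fps_nth (fps_const (a * b / c) * fps_hypergeo [a + 1, b + 1] [c + 1] 1) n"
    using one_add_of_nat_nonzero[of n] by (simp add: pochhammer_rec fact divide_simps del: fact_Suc)
qed

text \<open>
  Differentiation raises all three parameters by one, so a continuation for the raised parameters
  is, up to a factor, the derivative of one for the original parameters. Since the slit plane is
  starlike, it has a primitive there. This makes it enough to construct continuations for
  parameters with large real part, where the weight in Euler's integral is continuous.
\<close>

lemma hyp2f1_continuation_unshift:
  assumes c: "c \<notin> \<int>\<^sub>\<le>\<^sub>0"
    and F: "hyp2f1_continuation (a + 1) (b + 1) (c + 1) F"
  shows "\<exists>G. hyp2f1_continuation a b c G"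
proof -
  define k where "k = a * b / c"
  have hol: "F holomorphic_on slit_plane"
    and ser: "\<And>z. z \<in> ball 0 1 \<Longrightarrow> F z = eval_fps (fps_hypergeo [a + 1, b + 1] [c + 1] 1) z"
    using F by (auto simp: hyp2f1_continuation_def simp del: fps_hypergeo_nth)
  obtain g where g: "\<And>z. z \<in> slit_plane \<Longrightarrow> (g has_field_derivative k * F z) (at z)"
  proof -
    have "(\<lambda>z. k * F z) holomorphic_on slit_plane" by (intro holomorphic_intros hol)
    then show ?thesis
      using holomorphic_starlike_primitive[of slit_plane "\<lambda>z. k * F z" "{}"] that
      by (auto simp: holomorphic_on_imp_continuous_on starlike_slit_plane open_slit_plane
          holomorphic_on_imp_differentiable_at)
  qed
  define G where "G z = g z - g 0 + 1" for z
  have G: "(G has_field_derivative k * F z) (at z)" if "z \<in> slit_plane" for z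
    unfolding G_def using g[OF that] by (auto intro!: derivative_eq_intros)
  have sub: "ball 0 1 \<subseteq> slit_plane"
    by (auto simp: slit_plane_def)
  have "G z = eval_fps (fps_hypergeo [a, b] [c] 1) z" if z: "z \<in> ball 0 1" for z
  proof -
    have "((\<lambda>z. G z - eval_fps (fps_hypergeo [a, b] [c] 1) z) has_field_derivative 0) (at w within ball 0 1)"
      if w: "w \<in> ball 0 1" for w
    proof -
      have "ereal (norm w) < 1" using w by simp
      then have w': "ereal (norm w) < fps_conv_radius (fps_hypergeo [a, b] [c] 1)"
        "ereal (norm w) < fps_conv_radius (fps_hypergeo [a + 1, b + 1] [c + 1] 1)"
        using fps_conv_radius_2F1[OF c, of a b] fps_conv_radius_2F1[of "c + 1" "a + 1" "b + 1"]
          plus_one_in_nonpos_Ints_imp[of c] c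
        by (meson less_le_trans)+
      have "(eval_fps (fps_hypergeo [a, b] [c] 1) has_field_derivative
          eval_fps (fps_deriv (fps_hypergeo [a, b] [c] 1)) w) (at w within ball 0 1)"
        by (intro has_field_derivative_eval_fps w')
      also have "eval_fps (fps_deriv (fps_hypergeo [a, b] [c] 1)) w = k * F w"
        using w' by (simp add: fps_deriv_2F1[OF c] eval_fps_mult ser[OF w] k_def)
      finally show ?thesis
        using DERIV_diff[OF has_field_derivative_at_within[OF G]] w sub by fastforce
    qed
    then obtain d where "\<And>w. w \<in> ball 0 1 \<Longrightarrow> G w - eval_fps (fps_hypergeo [a, b] [c] 1) w = d"
      using has_field_derivative_zero_constant[of "ball 0 1" "\<lambda>w. G w - eval_fps (fps_hypergeo [a, b] [c] 1) w"]
      by auto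
    from this[of z] this[of 0] z
    have "G z - eval_fps (fps_hypergeo [a, b] [c] 1) z = G 0 - eval_fps (fps_hypergeo [a, b] [c] 1) 0"
      by simp
    then show ?thesis by (simp add: G_def eval_fps_at_0)
  qed
  moreover have "G holomorphic_on slit_plane"
    using G by (auto simp: holomorphic_on_open open_slit_plane)
  ultimately show ?thesis by (auto simp: hyp2f1_continuation_def)
qed

section \<open>Euler's integral\<close>

text \<open>
  By the Weierstrass theorem \<^term>\<open>g\<close> is uniformly within \<open>e\<close> of a polynomial, and vanishing
  moments make \<^term>\<open>g\<close> orthogonal to it; so the integral of \<open>g\<^sup>2\<close> is at most \<open>e\<close> times that
  of \<open>\<bar>g\<bar>\<close>, for every \<open>e > 0\<close>.
\<close>

lemma eq_zero_if_moments_vanish: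
  fixes g :: "real \<Rightarrow> real"
  assumes g: "continuous_on {0..1} g"
    and mom: "\<And>n. integral {0..1} (\<lambda>t. t ^ n * g t) = 0"
    and x: "x \<in> {0..1}"
  shows "g x = 0"
proof -
  have int: "f integrable_on {0..1}" if "continuous_on {0..1} f" for f :: "real \<Rightarrow> real"
    using that by (rule integrable_continuous_real)
  define A where "A = integral {0..1} (\<lambda>t. \<bar>g t\<bar>)"
  have A0: "A \<ge> 0"
    unfolding A_def by (intro integral_nonneg int continuous_intros g) auto
  have bound: "integral {0..1} (\<lambda>t. (g t)\<^sup>2) \<le> e * A" if e: "e > 0" for e
  proof -
    obtain p where p: "real_polynomial_function p"
      and close: "\<And>t. t \<in> {0..1} \<Longrightarrow> \<bar>g t - p t\<bar> < e"
      using Stone_Weierstrass_real_polynomial_function[OF compact_Icc g e] by blast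
    obtain a n where p_eq: "p = (\<lambda>t. \<Sum>i\<le>n. a i * t ^ i)"
      using p real_polynomial_function_iff_sum by blast
    have cp: "continuous_on {0..1} p"
      unfolding p_eq by (intro continuous_intros)
    have "integral {0..1} (\<lambda>t. p t * g t) = integral {0..1} (\<lambda>t. \<Sum>i\<le>n. a i * (t ^ i * g t))"
      unfolding p_eq by (simp add: sum_distrib_right mult.assoc)
    also have "\<dots> = (\<Sum>i\<le>n. integral {0..1} (\<lambda>t. a i * (t ^ i * g t)))"
      by (rule integral_sum) (auto intro!: int continuous_intros g)
    also have "\<dots> = 0"
      using mom by simp
    finally have orth: "integral {0..1} (\<lambda>t. p t * g t) = 0" .
    have "integral {0..1} (\<lambda>t. (g t)\<^sup>2)
        = integral {0..1} (\<lambda>t. (g t)\<^sup>2) - integral {0..1} (\<lambda>t. p t * g t)"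
      by (simp add: orth)
    also have "\<dots> = integral {0..1} (\<lambda>t. (g t)\<^sup>2 - p t * g t)"
      by (intro integral_diff[symmetric] int continuous_intros g cp)
    also have "\<dots> \<le> integral {0..1} (\<lambda>t. e * \<bar>g t\<bar>)"
    proof (intro integral_le int continuous_intros g cp)
      fix t :: real assume t: "t \<in> {0..1}"
      have "(g t)\<^sup>2 - p t * g t = (g t - p t) * g t"
        by (simp add: power2_eq_square algebra_simps)
      also have "\<dots> \<le> \<bar>g t - p t\<bar> * \<bar>g t\<bar>"
        by (metis abs_ge_self abs_mult)
      also have "\<dots> \<le> e * \<bar>g t\<bar>"
        using close[OF t] by (intro mult_right_mono) auto
      finally show "(g t)\<^sup>2 - p t * g t \<le> e * \<bar>g t\<bar>" .
    qed
    finally show ?thesis by (simp add: A_def)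
  qed
  have "integral {0..1} (\<lambda>t. (g t)\<^sup>2) \<le> 0"
  proof (rule field_le_epsilon)
    fix e :: real assume e: "e > 0"
    have "integral {0..1} (\<lambda>t. (g t)\<^sup>2) \<le> e / (A + 1) * A"
      using A0 e by (intro bound) auto
    also have "\<dots> \<le> 0 + e"
      using A0 e by (simp add: field_simps)
    finally show "integral {0..1} (\<lambda>t. (g t)\<^sup>2) \<le> 0 + e" .
  qed
  moreover have "integral {0..1} (\<lambda>t. (g t)\<^sup>2) \<ge> 0"
    by (intro integral_nonneg int continuous_intros g) auto
  ultimately have "integral {0..1} (\<lambda>t. (g t)\<^sup>2) = 0" by simp
  then have "\<forall>t\<in>{0..1}. (g t)\<^sup>2 = 0"
    by (subst (asm) integral_eq_0_iff) (auto intro!: continuous_intros g)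
  then show ?thesis using x by simp
qed

definition euler_weight :: "complex \<Rightarrow> complex \<Rightarrow> real \<Rightarrow> complex" where
  "euler_weight b c t = of_real t powr (b - 1) * (1 - of_real t) powr (c - b - 1)"

lemma continuous_on_euler_weight:
  assumes "Re b > 1" "Re (c - b) > 1"
  shows "continuous_on {0..1} (euler_weight b c)"
proof -
  have "continuous_on {0..1} (\<lambda>t. complex_of_real t powr (b - 1))"
    by (rule continuous_on_powr_complex) (use assms in \<open>auto intro!: continuous_intros\<close>)
  moreover have "continuous_on {0..1} (\<lambda>t. (1 - complex_of_real t) powr (c - b - 1))"
    by (rule continuous_on_powr_complex) (use assms in \<open>auto intro!: continuous_intros\<close>)
  ultimately show ?thesis
    unfolding euler_weight_def by (rule continuous_on_mult)
qed

text \<open>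
  The difference of the two sides is the integral over the unit interval of the derivative of
  \<open>t\<^bsup>b + n\<^esup> (1 - t)\<^bsup>c - b\<^esup>\<close>, which vanishes at both end points.
\<close>

lemma euler_moment_rec:
  assumes bc: "Re b > 1" "Re (c - b) > 1"
  defines "M \<equiv> \<lambda>n. integral {0..1} (\<lambda>t. of_real t ^ n * euler_weight b c t)"
  shows "(c + of_nat n) * M (Suc n) = (b + of_nat n) * M n"
proof -
  have cont: "continuous_on {0..1} (\<lambda>t. of_real t ^ m * euler_weight b c t)" for m
    by (intro continuous_intros continuous_on_euler_weight bc)
  define P where "P t = of_real t powr (b + of_nat n) * (1 - of_real t) powr (c - b)" for t :: real
  define P' where "P' t = (b + of_nat n) * (of_real t ^ n * euler_weight b c t)
    - (c + of_nat n) * (of_real t ^ Suc n * euler_weight b c t)" for t :: real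
  have "(P' has_integral (P 1 - P 0)) {0..1}"
  proof (rule fundamental_theorem_of_calculus_interior)
    show "continuous_on {0..1} P"
      unfolding P_def using bc
      by (intro continuous_intros continuous_on_powr_complex) auto
    fix t :: real assume t: "t \<in> {0<..<1}"
    have nz: "complex_of_real t \<notin> \<real>\<^sub>\<le>\<^sub>0" "1 - complex_of_real t \<notin> \<real>\<^sub>\<le>\<^sub>0"
      using t by (auto simp: complex_nonpos_Reals_iff)
    have t0: "complex_of_real t \<noteq> 0" "1 - complex_of_real t \<noteq> 0"
      using nz by auto
    have split_t: "complex_of_real t powr (b + of_nat n - 1) = of_real t ^ n * of_real t powr (b - 1)"
      "complex_of_real t powr (b + of_nat n) = of_real t ^ Suc n * of_real t powr (b - 1)"
      "(1 - complex_of_real t) powr (c - b) = (1 - of_real t) * (1 - of_real t) powr (c - b - 1)"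
      using t0 by (simp_all add: powr_diff powr_add powr_nat')
    have "((\<lambda>z. z powr (b + of_nat n) * (1 - z) powr (c - b)) has_field_derivative
        (b + of_nat n) * of_real t powr (b + of_nat n - 1) * (1 - of_real t) powr (c - b)
        + of_real t powr (b + of_nat n) * (- (c - b) * (1 - of_real t) powr (c - b - 1)))
        (at (of_real t))"
      using nz by (auto intro!: derivative_eq_intros simp: algebra_simps)
    also have "(b + of_nat n) * of_real t powr (b + of_nat n - 1) * (1 - of_real t) powr (c - b)
        + of_real t powr (b + of_nat n) * (- (c - b) * (1 - of_real t) powr (c - b - 1)) = P' t"
      unfolding P'_def euler_weight_def split_t by (simp add: algebra_simps)
    finally show "(P has_vector_derivative P' t) (at t)"
      unfolding P_def by (rule has_vector_derivative_real_field)
  qed auto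
  moreover have "P 1 = 0" "P 0 = 0"
    using bc by (auto simp: P_def)
  ultimately have "integral {0..1} P' = 0"
    by (simp add: integral_unique)
  moreover have "integral {0..1} P' = (b + of_nat n) * M n - (c + of_nat n) * M (Suc n)"
    unfolding P'_def M_def
    by (subst integral_diff)
       (auto intro!: integrable_continuous_real continuous_intros continuous_on_euler_weight bc)
  ultimately show ?thesis by simp
qed

text \<open>
  The zeroth moment is the Beta value by which Euler's integral has to be divided. If it were zero,
  the recurrence would annihilate all moments, and then the weight itself.
\<close>

lemma euler_moment_0_nonzero:
  assumes bc: "Re b > 1" "Re (c - b) > 1" and c: "c \<notin> \<int>\<^sub>\<le>\<^sub>0"
  shows "integral {0..1} (euler_weight b c) \<noteq> 0"
proof
  assume zero: "integral {0..1} (euler_weight b c) = 0"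
  have mom: "integral {0..1} (\<lambda>t. of_real t ^ n * euler_weight b c t) = 0" for n
  proof (induction n)
    case (Suc n)
    have "c + of_nat n \<noteq> 0"
      by (rule add_of_nat_nonzero[OF c])
    then show ?case using euler_moment_rec[OF bc, of n] Suc by simp
  qed (simp add: zero)
  have int: "(\<lambda>t. of_real t ^ n * euler_weight b c t) integrable_on {0..1}" for n
    by (intro integrable_continuous_real continuous_intros continuous_on_euler_weight bc)
  have "Re (euler_weight b c (1/2)) = 0"
  proof (rule eq_zero_if_moments_vanish[where g = "\<lambda>t. Re (euler_weight b c t)"])
    show "continuous_on {0..1} (\<lambda>t. Re (euler_weight b c t))"
      by (intro continuous_intros continuous_on_euler_weight bc)
    show "integral {0..1} (\<lambda>t. t ^ n * Re (euler_weight b c t)) = 0" for n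
      using integral_linear[OF int[of n] bounded_linear_Re] mom[of n]
      by (simp add: o_def flip: of_real_power)
  qed auto
  moreover have "Im (euler_weight b c (1/2)) = 0"
  proof (rule eq_zero_if_moments_vanish[where g = "\<lambda>t. Im (euler_weight b c t)"])
    show "continuous_on {0..1} (\<lambda>t. Im (euler_weight b c t))"
      by (intro continuous_intros continuous_on_euler_weight bc)
    show "integral {0..1} (\<lambda>t. t ^ n * Im (euler_weight b c t)) = 0" for n
      using integral_linear[OF int[of n] bounded_linear_Im] mom[of n]
      by (simp add: o_def flip: of_real_power)
  qed auto
  ultimately have "euler_weight b c (1/2) = 0"
    by (simp add: complex_eq_iff)
  then show False by (simp add: euler_weight_def)
qed

lemma euler_moment:
  assumes bc: "Re b > 1" "Re (c - b) > 1" and c: "c \<notin> \<int>\<^sub>\<le>\<^sub>0"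
  shows "integral {0..1} (\<lambda>t. of_real t ^ n * euler_weight b c t)
    = integral {0..1} (euler_weight b c) * pochhammer b n / pochhammer c n"
proof (induction n)
  case (Suc n)
  have "c + of_nat n \<noteq> 0"
    by (rule add_of_nat_nonzero[OF c])
  then have "integral {0..1} (\<lambda>t. of_real t ^ Suc n * euler_weight b c t)
      = (b + of_nat n) * integral {0..1} (\<lambda>t. of_real t ^ n * euler_weight b c t) / (c + of_nat n)"
    unfolding euler_moment_rec[OF bc, of n, symmetric]
    by (rule nonzero_mult_div_cancel_left[symmetric])
  then show ?case
    unfolding Suc.IH pochhammer_Suc by (simp only: times_divide_eq_right divide_divide_eq_left mult_ac)
qed simp

lemma continuous_on_powr_off_nonpos:
  fixes f :: "'a::topological_space \<Rightarrow> complex"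
  assumes "continuous_on A f" "\<And>x. x \<in> A \<Longrightarrow> f x \<notin> \<real>\<^sub>\<le>\<^sub>0"
  shows "continuous_on A (\<lambda>x. f x powr s)"
proof (rule continuous_on_powr_complex)
  show "A \<subseteq> {x. Re (f x) \<ge> 0 \<or> Im (f x) \<noteq> 0}"
    using assms(2) by (force simp: complex_nonpos_Reals_iff)
  show "Re s > 0" if "x \<in> A" "f x = 0" for x
    using assms(2)[OF that(1)] that(2) by simp
qed (auto intro: assms)

definition euler_integral :: "complex \<Rightarrow> complex \<Rightarrow> complex \<Rightarrow> complex \<Rightarrow> complex" where
  "euler_integral a b c z =
     integral {0..1} (\<lambda>t. euler_weight b c t * (1 - z * of_real t) powr (- a))"

lemma euler_integral_holomorphic:
  assumes bc: "Re b > 1" "Re (c - b) > 1"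
  shows "euler_integral a b c holomorphic_on slit_plane"
proof -
  have hol_ball: "euler_integral a b c holomorphic_on ball z0 e" if sub: "ball z0 e \<subseteq> slit_plane" for z0 e
  proof -
    have nz: "1 - z * of_real t \<notin> \<real>\<^sub>\<le>\<^sub>0" if "z \<in> ball z0 e" "t \<in> {0..1}" for z t
      using slit_plane_scale[of z t] that sub by (auto simp: slit_plane_iff)
    have "(\<lambda>z. integral (cbox 0 1) (\<lambda>t. euler_weight b c t * (1 - z * of_real t) powr (- a)))
        holomorphic_on ball z0 e"
    proof (rule leibniz_rule_holomorphic)
      fix z and t :: real assume z: "z \<in> ball z0 e" and "t \<in> cbox 0 1"
      then have "1 - z * of_real t \<notin> \<real>\<^sub>\<le>\<^sub>0" using nz by auto
      then show "((\<lambda>z. euler_weight b c t * (1 - z * of_real t) powr (- a)) has_field_derivative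
          euler_weight b c t * (of_real t * a * (1 - z * of_real t) powr (- a - 1)))
          (at z within ball z0 e)"
        by (auto intro!: derivative_eq_intros)
    next
      fix z assume z: "z \<in> ball z0 e"
      have "continuous_on {0..1} (\<lambda>t. euler_weight b c t * (1 - z * of_real t) powr (- a))"
        by (intro continuous_on_mult continuous_on_euler_weight bc continuous_on_powr_off_nonpos
              continuous_intros nz z)
      then show "(\<lambda>t. euler_weight b c t * (1 - z * of_real t) powr (- a)) integrable_on cbox 0 1"
        by (auto intro: integrable_continuous_real)
    next
      have "continuous_on (ball z0 e \<times> cbox 0 1) (\<lambda>x. euler_weight b c (snd x))"
        by (rule continuous_on_compose2[OF continuous_on_euler_weight[OF bc]])
           (auto intro!: continuous_intros)
      moreover have "continuous_on (ball z0 e \<times> cbox 0 1)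
          (\<lambda>x. (1 - fst x * of_real (snd x)) powr (- a - 1))"
        by (intro continuous_on_powr_off_nonpos continuous_intros nz) auto
      ultimately show "continuous_on (ball z0 e \<times> cbox 0 1)
          (\<lambda>(z, t). euler_weight b c t * (of_real t * a * (1 - z * of_real t) powr (- a - 1)))"
        unfolding case_prod_unfold
        by (intro continuous_on_mult continuous_on_of_real continuous_on_snd continuous_on_id
            continuous_on_const)
    qed auto
    then show ?thesis by (simp add: euler_integral_def[abs_def])
  qed
  have "euler_integral a b c analytic_on slit_plane"
    unfolding analytic_on_def
  proof
    fix z0 assume "z0 \<in> slit_plane"
    then obtain e where "e > 0" "ball z0 e \<subseteq> slit_plane"
      by (rule openE[OF open_slit_plane])
    then show "\<exists>e>0. euler_integral a b c holomorphic_on ball z0 e"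
      using hol_ball by (intro exI[of _ e] conjI)
  qed
  then show ?thesis
    by (rule analytic_imp_holomorphic)
qed

text \<open>
  Expand \<open>(1 - z t)\<^bsup>-a\<^esup>\<close> binomially and integrate term by term; the moments of the weight turn
  the binomial coefficients into hypergeometric ones.
\<close>

lemma euler_integral_series:
  assumes bc: "Re b > 1" "Re (c - b) > 1" and c: "c \<notin> \<int>\<^sub>\<le>\<^sub>0" and z: "norm z < 1"
  shows "euler_integral a b c z
    = integral {0..1} (euler_weight b c) * eval_fps (fps_hypergeo [a, b] [c] 1) z"
proof -
  define M where "M = integral {0..1} (euler_weight b c)"
  define T where "T n t = euler_weight b c t * (pochhammer a n / fact n * (z * of_real t) ^ n)"
    for n and t :: real
  have binom: "(\<lambda>n. pochhammer a n / fact n * w ^ n) sums (1 - w) powr (- a)" if "norm w < 1" for w :: complex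
  proof -
    have "((- a) gchoose n) * (- w) ^ n = pochhammer a n / fact n * w ^ n" for n
      by (cases "even n") (simp_all add: gbinomial_pochhammer)
    then show ?thesis
      using gen_binomial_complex[of "- w" "- a"] that by simp
  qed
  have cont: "continuous_on {0..1} (T n)" for n
    unfolding T_def by (intro continuous_intros continuous_on_euler_weight bc)
  obtain B where B: "\<And>t. t \<in> {0..1} \<Longrightarrow> norm (euler_weight b c t) \<le> B"
    using compact_imp_bounded[OF compact_continuous_image[OF continuous_on_euler_weight[OF bc] compact_Icc]]
    unfolding bounded_iff by blast
  have cont_sum: "continuous_on {0..1} (\<lambda>t. \<Sum>i<n. T i t)" for n
    by (intro continuous_on_sum cont)
  have unif: "uniform_limit {0..1} (\<lambda>n t. \<Sum>i<n. T i t) (\<lambda>t. \<Sum>i. T i t) sequentially"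
  proof (rule Weierstrass_m_test)
    fix n and t :: real assume t: "t \<in> {0..1}"
    have "norm (T n t) = norm (euler_weight b c t) * (norm (pochhammer a n / fact n) * (norm z * t) ^ n)"
      using t unfolding T_def norm_mult norm_power by simp
    also have "\<dots> \<le> B * (norm (pochhammer a n / fact n) * norm z ^ n)"
    proof (intro mult_mono power_mono B t)
      show "norm z * t \<le> norm z" using t by (intro mult_left_le) auto
      show "0 \<le> B" using B[OF t] norm_ge_zero order_trans by blast
    qed (use t in auto)
    finally show "norm (T n t) \<le> B * (norm (pochhammer a n / fact n) * norm z ^ n)" .
  next
    obtain r where r: "norm z < r" "r < 1" using z dense by blast
    have r0: "0 \<le> r" using r(1) norm_ge_zero[of z] by linarith
    then have "norm (complex_of_real r) < 1" using r by simp
    from sums_summable[OF binom[OF this]]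
    have "summable (\<lambda>n. norm (pochhammer a n / fact n * z ^ n))"
      by (rule powser_insidea) (use r r0 in simp)
    then show "summable (\<lambda>n. B * (norm (pochhammer a n / fact n) * norm z ^ n))"
      unfolding norm_mult norm_power by (rule summable_mult)
  qed
  obtain I J where IJ: "\<And>n. ((\<lambda>t. \<Sum>i<n. T i t) has_integral I n) {0..1}"
    "((\<lambda>t. \<Sum>i. T i t) has_integral J) {0..1}" "I \<longlonglongrightarrow> J"
    by (rule uniform_limit_integral[OF unif cont_sum sequentially_bot]) (rule that)
  have "(\<Sum>i. T i t) = euler_weight b c t * (1 - z * of_real t) powr (- a)" if t: "t \<in> {0..1}" for t
  proof -
    have "norm (z * of_real t) \<le> norm z * 1"
      using t unfolding norm_mult by (intro mult_left_mono) auto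
    then have "norm (z * of_real t) < 1" using z by simp
    from sums_mult[OF binom[OF this]] show ?thesis
      unfolding T_def by (rule sums_unique[symmetric])
  qed
  then have "integral {0..1} (\<lambda>t. \<Sum>i. T i t) = euler_integral a b c z"
    unfolding euler_integral_def by (rule integral_cong)
  then have J: "J = euler_integral a b c z"
    using integral_unique[OF IJ(2)] by simp
  have int_T: "integral {0..1} (T i) = M * (fps_nth (fps_hypergeo [a, b] [c] 1) i * z ^ i)" for i
  proof -
    have "integral {0..1} (T i)
        = integral {0..1} (\<lambda>t. pochhammer a i / fact i * z ^ i * (of_real t ^ i * euler_weight b c t))"
      by (rule integral_cong) (simp add: T_def power_mult_distrib)
    also have "\<dots> = pochhammer a i / fact i * z ^ i * (M * pochhammer b i / pochhammer c i)"
      unfolding integral_mult_right euler_moment[OF bc c] M_def ..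
    also have "\<dots> = M * (pochhammer a i * pochhammer b i / (pochhammer c i * fact i) * z ^ i)"
      by (simp only: times_divide_eq_right times_divide_eq_left divide_divide_eq_left mult_ac)
    also have "pochhammer a i * pochhammer b i / (pochhammer c i * fact i)
        = fps_nth (fps_hypergeo [a, b] [c] 1) i"
      by simp
    finally show ?thesis .
  qed
  have "I = (\<lambda>n. \<Sum>i<n. M * (fps_nth (fps_hypergeo [a, b] [c] 1) i * z ^ i))"
  proof
    fix n
    have "I n = (\<Sum>i<n. integral {0..1} (T i))"
      using integral_unique[OF IJ(1)[of n]]
      by (subst (asm) integral_sum) (auto intro: integrable_continuous_real cont)
    then show "I n = (\<Sum>i<n. M * (fps_nth (fps_hypergeo [a, b] [c] 1) i * z ^ i))"
      unfolding int_T .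
  qed
  then have "(\<lambda>i. M * (fps_nth (fps_hypergeo [a, b] [c] 1) i * z ^ i)) sums J"
    using IJ(3) by (simp only: sums_def)
  moreover have "(\<lambda>i. M * (fps_nth (fps_hypergeo [a, b] [c] 1) i * z ^ i)) sums
      (M * eval_fps (fps_hypergeo [a, b] [c] 1) z)"
  proof (intro sums_mult sums_eval_fps)
    have "ereal (norm z) < 1" using z by simp
    then show "ereal (norm z) < fps_conv_radius (fps_hypergeo [a, b] [c] 1)"
      using fps_conv_radius_2F1[OF c] by (rule less_le_trans)
  qed
  ultimately show ?thesis
    unfolding J M_def by (rule sums_unique2)
qed

lemma hyp2f1_continuation_exists_euler:
  assumes bc: "Re b > 1" "Re (c - b) > 1" and c: "c \<notin> \<int>\<^sub>\<le>\<^sub>0"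
  shows "\<exists>F. hyp2f1_continuation a b c F"
proof -
  define M where "M = integral {0..1} (euler_weight b c)"
  have M: "M \<noteq> 0" unfolding M_def by (rule euler_moment_0_nonzero[OF bc c])
  have "hyp2f1_continuation a b c (\<lambda>z. euler_integral a b c z / M)"
    unfolding hyp2f1_continuation_def
  proof (intro conjI ballI)
    show "(\<lambda>z. euler_integral a b c z / M) holomorphic_on slit_plane"
      using M by (intro holomorphic_intros euler_integral_holomorphic bc)
    show "euler_integral a b c z / M = eval_fps (fps_hypergeo [a, b] [c] 1) z" if "z \<in> ball 0 1" for z
    proof -
      have "norm z < 1" using that by simp
      from euler_integral_series[OF bc c this, of a]
      show ?thesis unfolding M_def[symmetric] by (simp only: nonzero_mult_div_cancel_left[OF M])
    qed
  qed
  then show ?thesis by blast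
qed

text \<open>
  Two shifts raise \<^term>\<open>Re b\<close> by \<open>2\<close> and leave \<^term>\<open>c - b\<close> unchanged. The case needed below has
  \<^term>\<open>b\<close> purely imaginary. There the weight in Euler's integral has modulus of order \<open>1 / t\<close>
  near \<open>0\<close>; after one shift it is bounded but may oscillate, after two it is continuous.
\<close>

lemma hyp2f1_continuation_exists:
  assumes b: "Re b > - 1" and cb: "Re (c - b) > 1"
  shows "\<exists>F. hyp2f1_continuation a b c F"
proof -
  have c: "c \<notin> \<int>\<^sub>\<le>\<^sub>0" "c + 1 \<notin> \<int>\<^sub>\<le>\<^sub>0" "c + 1 + 1 \<notin> \<int>\<^sub>\<le>\<^sub>0"
    by (rule Re_pos_imp_not_nonpos_Int, use b cb in simp)+
  have "Re (b + 1 + 1) > 1" "Re ((c + 1 + 1) - (b + 1 + 1)) > 1"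
    using b cb by simp_all
  from hyp2f1_continuation_exists_euler[OF this c(3), of "a + 1 + 1"]
  obtain F where "hyp2f1_continuation (a + 1 + 1) (b + 1 + 1) (c + 1 + 1) F"
    by (rule exE)
  from hyp2f1_continuation_unshift[OF c(2) this]
  obtain G where "hyp2f1_continuation (a + 1) (b + 1) (c + 1) G"
    by (rule exE)
  from hyp2f1_continuation_unshift[OF c(1) this] show ?thesis .
qed

section \<open>The hypergeometric equation on the slit plane\<close>

lemma fps_hypergeo_2F1_ode:
  fixes a b c :: complex
  assumes c: "c \<notin> \<int>\<^sub>\<le>\<^sub>0"
  defines "f \<equiv> fps_hypergeo [a, b] [c] 1"
  shows "fps_X * (1 - fps_X) * fps_deriv (fps_deriv f)
    + (fps_const c - fps_const (a + b + 1) * fps_X) * fps_deriv f - fps_const (a * b) * f = 0"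
proof -
  have "fps_X * fps_deriv (fps_deriv f) - fps_X * (fps_X * fps_deriv (fps_deriv f))
    + fps_const c * fps_deriv f - fps_const (a + b + 1) * (fps_X * fps_deriv f)
    - fps_const (a * b) * f = 0"
  proof (rule fps_ext)
    fix n
    define g where "g = fps_nth f"
    have cn: "c + of_nat n \<noteq> 0"
      by (rule add_of_nat_nonzero[OF c])
    note n1 = one_add_of_nat_nonzero[of n]
    have "g (Suc n) = (a + of_nat n) * (b + of_nat n) / ((1 + of_nat n) * (c + of_nat n)) * g n"
      unfolding g_def f_def fps_hypergeo_rec by simp
    then have rec: "(1 + of_nat n) * (c + of_nat n) * g (Suc n) = (a + of_nat n) * (b + of_nat n) * g n"
      using cn n1 by simp
    have XX: "fps_nth (fps_X * (fps_X * fps_deriv (fps_deriv f))) n = of_nat n * (of_nat n - 1) * g n"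
      by (cases n; cases "n - 1") (simp_all add: g_def)
    have X: "fps_nth (fps_X * fps_deriv (fps_deriv f)) n = of_nat n * (1 + of_nat n) * g (Suc n)"
      "fps_nth (fps_X * fps_deriv f) n = of_nat n * g n"
      by (cases n; simp add: g_def)+
    have D: "fps_nth (fps_deriv f) n = (1 + of_nat n) * g (Suc n)"
      by (simp add: g_def)
    have "of_nat n * (1 + of_nat n) * g (Suc n) - of_nat n * (of_nat n - 1) * g n
      + c * ((1 + of_nat n) * g (Suc n)) - (a + b + 1) * (of_nat n * g n) - a * b * g n = 0"
      using rec by algebra
    then show "fps_nth (fps_X * fps_deriv (fps_deriv f) - fps_X * (fps_X * fps_deriv (fps_deriv f))
      + fps_const c * fps_deriv f - fps_const (a + b + 1) * (fps_X * fps_deriv f)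
      - fps_const (a * b) * f) n = fps_nth 0 n"
      unfolding fps_sub_nth fps_add_nth fps_mult_left_const_nth XX X D g_def[symmetric]
      by (simp only: fps_zero_nth)
  qed
  then show ?thesis by (simp add: algebra_simps)
qed

text \<open>
  The equation holds coefficientwise for the series at \<open>0\<close>, and the identity theorem carries it
  to the whole slit plane.
\<close>

lemma hyp2f1_continuation_ode:
  assumes c: "c \<notin> \<int>\<^sub>\<le>\<^sub>0" and F: "hyp2f1_continuation a b c F" and z: "z \<in> slit_plane"
  shows "z * (1 - z) * deriv (deriv F) z + (c - (a + b + 1) * z) * deriv F z - a * b * F z = 0"
proof -
  define f where "f = fps_hypergeo [a, b] [c] 1"
  define L where "L z = z * (1 - z) * deriv (deriv F) z + (c - (a + b + 1) * z) * deriv F z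
    - a * b * F z" for z
  have hol: "F holomorphic_on slit_plane"
    and ser: "\<And>z. z \<in> ball 0 1 \<Longrightarrow> F z = eval_fps f z"
    using F by (simp_all only: hyp2f1_continuation_def f_def)
  have "F has_fps_expansion f"
    unfolding has_fps_expansion_def
  proof
    show "fps_conv_radius f > 0"
      using fps_conv_radius_2F1[OF c, of a b] unfolding f_def
      by (rule less_le_trans[rotated]) simp
    have "\<forall>\<^sub>F z in nhds 0. z \<in> ball (0 :: complex) 1"
      by (intro eventually_nhds_in_open) auto
    then show "\<forall>\<^sub>F z in nhds 0. eval_fps f z = F z"
      by (rule eventually_mono) (simp only: ser)
  qed
  then have "L has_fps_expansion
      fps_X * (1 - fps_X) * fps_deriv (fps_deriv f)
      + (fps_const c - fps_const (a + b + 1) * fps_X) * fps_deriv f - fps_const (a * b) * f"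
    unfolding L_def by (intro fps_expansion_intros)
  then have "L has_fps_expansion 0"
    unfolding f_def fps_hypergeo_2F1_ode[OF c] .
  then have "\<forall>\<^sub>F z in nhds 0. L z = 0"
    by (auto simp: has_fps_expansion_def elim: eventually_mono)
  then obtain S where S: "open S" "0 \<in> S" "\<And>z. z \<in> S \<Longrightarrow> L z = 0"
    by (auto simp: eventually_nhds)
  have sub: "S \<inter> ball 0 1 \<subseteq> slit_plane"
    by (auto simp: slit_plane_def)
  have "L holomorphic_on slit_plane"
    unfolding L_def by (intro holomorphic_intros hol open_slit_plane)
  then have "L z = 0"
  proof (rule analytic_continuation_open[of "S \<inter> ball 0 1" slit_plane L "\<lambda>_. 0", rotated 5])
    show "S \<inter> ball 0 1 \<noteq> {}" using S(2) by auto
  qed (use S sub z open_slit_plane connected_slit_plane in auto)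
  then show ?thesis unfolding L_def .
qed

section \<open>The energy of a modulated Jacobi function\<close>

text \<open>
  The derivative of the energy \<open>\<bar>u\<bar>\<^sup>2 + l\<^sup>2 \<bar>h\<bar>\<^sup>2\<close>. The modulation term is a rotation of
  \<^term>\<open>u\<close>, so it does no work. The terms in \<open>l\<^sup>2\<close> cancel. What is left is damping, with
  coefficient at least \<open>W C / S\<close> because \<open>\<beta> \<ge> - 1/2\<close>, against a coupling of size \<open>\<bar>l \<beta>\<bar>\<close>;
  completing the square in \<^term>\<open>norm u\<close> absorbs the coupling up to the stated remainder.
\<close>

lemma jacobi_energy_rate:
  fixes u h :: complex and \<alpha> \<beta> l C S :: real
  assumes \<alpha>: "\<alpha> > 0" and \<beta>: "\<beta> \<ge> - 1/2" and S: "S > 0" and C: "C > 0" "C\<^sup>2 = 1 + S\<^sup>2"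
  defines "W \<equiv> 2 * \<alpha> + 1 / C\<^sup>2"
    and "u' \<equiv> - (of_real ((2 * \<alpha> + 1) * C / S + 2 * \<beta> * S / C) + \<i> * of_real (2 * l * S / C)) * u
        - (of_real (l\<^sup>2) - \<i> * of_real (2 * l * \<beta>)) / of_real C * h"
  shows "2 * (u \<bullet> u') + 2 * l\<^sup>2 * (h \<bullet> (u / of_real C))
      \<le> 2 * \<beta>\<^sup>2 * (S / C ^ 3) / W * (l\<^sup>2 * (norm h)\<^sup>2)"
proof -
  define D where "D = (2 * \<alpha> + 1) * C / S + 2 * \<beta> * S / C"
  define p q where "p = norm u" and "q = norm h"
  have W: "W > 0" unfolding W_def using \<alpha> C(1) by (intro add_pos_pos) auto
  have pq: "p \<ge> 0" "q \<ge> 0" by (auto simp: p_def q_def)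
  have u'_eq: "u' = - (D *\<^sub>R u) - (2 * l * S / C) *\<^sub>R (\<i> * u) - (l\<^sup>2 / C) *\<^sub>R h + (2 * l * \<beta> / C) *\<^sub>R (\<i> * h)"
    unfolding u'_def D_def[symmetric] using C(1)
    by (simp add: scaleR_conv_of_real field_simps)
  have rot: "u \<bullet> (\<i> * u) = 0"
    by (simp add: inner_complex_def)
  have hu: "h \<bullet> (u / of_real C) = (u \<bullet> h) / C"
    by (simp add: inner_complex_def divide_simps algebra_simps)
  have "2 * (u \<bullet> u') + 2 * l\<^sup>2 * (h \<bullet> (u / of_real C)) = - 2 * D * p\<^sup>2 + (4 * l * \<beta> / C) * (u \<bullet> (\<i> * h))"
    unfolding u'_eq hu p_def
    by (simp add: inner_diff_right inner_add_right rot power2_norm_eq_inner field_simps)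
  also have "\<dots> \<le> - 2 * (C / S * W) * p\<^sup>2 + 4 * (\<bar>l * \<beta>\<bar> / C) * (p * q)"
  proof (intro add_mono)
    have "C / S - C / S * (1 / C\<^sup>2) = (C\<^sup>2 - 1) / (S * C)"
      using S C(1) by (simp add: field_simps power2_eq_square)
    also have "\<dots> = S / C"
      unfolding C(2) using S by (simp add: power2_eq_square)
    finally have key: "C / S - C / S * (1 / C\<^sup>2) = S / C" .
    have "D - C / S * W = (C / S - C / S * (1 / C\<^sup>2)) + 2 * \<beta> * (S / C)"
      unfolding D_def W_def by (simp add: algebra_simps add_divide_distrib)
    then have "D - C / S * W = (1 + 2 * \<beta>) * (S / C)"
      unfolding key by (simp add: distrib_right add_divide_distrib)
    moreover have "(1 + 2 * \<beta>) * (S / C) \<ge> 0"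
      using \<beta> S C(1) by (intro mult_nonneg_nonneg) auto
    ultimately have "C / S * W \<le> D" by linarith
    then have "- 2 * D \<le> - 2 * (C / S * W)" by linarith
    then show "- 2 * D * p\<^sup>2 \<le> - 2 * (C / S * W) * p\<^sup>2"
      by (intro mult_right_mono) auto
    have "(4 * l * \<beta> / C) * (u \<bullet> (\<i> * h)) \<le> \<bar>4 * l * \<beta> / C\<bar> * \<bar>u \<bullet> (\<i> * h)\<bar>"
      by (metis abs_ge_self abs_mult)
    also have "\<dots> \<le> \<bar>4 * l * \<beta> / C\<bar> * (p * q)"
      using Cauchy_Schwarz_ineq2[of u "\<i> * h"] by (intro mult_left_mono) (auto simp: p_def q_def norm_mult)
    also have "\<bar>4 * l * \<beta> / C\<bar> = 4 * (\<bar>l * \<beta>\<bar> / C)"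
      using C(1) by (simp add: abs_mult)
    finally show "(4 * l * \<beta> / C) * (u \<bullet> (\<i> * h)) \<le> 4 * (\<bar>l * \<beta>\<bar> / C) * (p * q)" .
  qed
  also have "\<dots> \<le> 2 * \<beta>\<^sup>2 * (S / C ^ 3) / W * (l\<^sup>2 * q\<^sup>2)"
  proof -
    define m where "m = \<bar>l * \<beta>\<bar>"
    have m2: "m\<^sup>2 = l\<^sup>2 * \<beta>\<^sup>2" by (simp add: m_def power_mult_distrib)
    have "0 \<le> 2 * (C / S * W) * (p - m * q * S / (C\<^sup>2 * W))\<^sup>2"
      using S C(1) W by simp
    also have "\<dots> = 2 * (C / S * W) * p\<^sup>2 - 4 * (m / C) * (p * q) + 2 * m\<^sup>2 * q\<^sup>2 * S / (C ^ 3 * W)"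
      using S C(1) W by (simp add: field_simps power2_eq_square power3_eq_cube)
    finally have "0 \<le> 2 * (C / S * W) * p\<^sup>2 - 4 * (m / C) * (p * q) + 2 * m\<^sup>2 * q\<^sup>2 * S / (C ^ 3 * W)" .
    moreover have "2 * m\<^sup>2 * q\<^sup>2 * S / (C ^ 3 * W) = 2 * \<beta>\<^sup>2 * (S / C ^ 3) / W * (l\<^sup>2 * q\<^sup>2)"
      unfolding m2 by simp
    ultimately show ?thesis unfolding m_def by linarith
  qed
  finally show ?thesis unfolding q_def .
qed

text \<open>
  The Gudermannian \<open>arctan (sinh t)\<close> is the primitive of \<open>1 / cosh t\<close>. It is used as a comparison
  function because it is of order \<open>min 1 t\<close> on the half-line.
\<close>

lemma gudermannian_deriv:
  "((\<lambda>t. arctan (sinh t)) has_real_derivative 1 / cosh t) (at (t::real))"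
proof -
  have "((\<lambda>t. arctan (sinh t)) has_real_derivative inverse (1 + (sinh t)\<^sup>2) * cosh t) (at t)"
    by (auto intro!: derivative_eq_intros)
  also have "inverse (1 + (sinh t)\<^sup>2) * cosh t = 1 / cosh t"
  proof -
    have "1 + (sinh t)\<^sup>2 = (cosh t)\<^sup>2" by (simp add: cosh_square_eq)
    then show ?thesis
      using cosh_real_pos[of t] by (simp add: power2_eq_square divide_simps)
  qed
  finally show ?thesis .
qed

lemma tanh_le_gudermannian:
  assumes "0 \<le> t"
  shows "sinh t / cosh t \<le> arctan (sinh (t::real))"
proof -
  have "arctan (sinh 0) - sinh 0 / cosh 0 \<le> arctan (sinh t) - sinh t / cosh t"
  proof (rule DERIV_nonneg_imp_nondecreasing[OF assms])
    fix x :: real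
    have C: "cosh x \<ge> 1" "cosh x \<noteq> 0" using cosh_real_ge_1[of x] by auto
    have "((\<lambda>t. arctan (sinh t) - sinh t / cosh t) has_real_derivative
        1 / cosh x - (cosh x * cosh x - sinh x * sinh x) / (cosh x * cosh x)) (at x)"
      using C by (intro DERIV_diff gudermannian_deriv DERIV_divide derivative_intros) 
        (auto intro!: derivative_eq_intros)
    also have "(cosh x * cosh x - sinh x * sinh x) = 1"
      using cosh_square_eq[of x] by (simp add: power2_eq_square)
    finally have "((\<lambda>t. arctan (sinh t) - sinh t / cosh t) has_real_derivative
        1 / cosh x - 1 / (cosh x * cosh x)) (at x)" .
    moreover have "1 / cosh x - 1 / (cosh x * cosh x) \<ge> 0"
      using C by (simp add: field_simps)
    ultimately show "\<exists>y. ((\<lambda>t. arctan (sinh t) - sinh t / cosh t) has_real_derivative y) (at x) \<and> 0 \<le> y"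
      by blast
  qed
  then show ?thesis by simp
qed

lemma gudermannian_le:
  assumes "0 \<le> (t::real)"
  shows "arctan (sinh t) \<le> 2 * min 1 t"
proof -
  have "arctan (sinh 0) - 0 \<ge> arctan (sinh t) - t"
  proof (rule DERIV_nonpos_imp_nonincreasing[OF assms])
    fix x :: real
    have "((\<lambda>t. arctan (sinh t) - t) has_real_derivative 1 / cosh x - 1) (at x)"
      by (intro DERIV_diff gudermannian_deriv DERIV_ident)
    moreover have "1 / cosh x - 1 \<le> 0"
      using cosh_real_ge_1[of x] by (simp add: field_simps)
    ultimately show "\<exists>y. ((\<lambda>t. arctan (sinh t) - t) has_real_derivative y) (at x) \<and> y \<le> 0"
      by blast
  qed
  moreover have "arctan (sinh t) \<le> 2"
    using arctan_ubound[of "sinh t"] pi_less_4 by linarith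
  ultimately show ?thesis using assms by (auto simp: min_def)
qed

text \<open>
  Here \<^term>\<open>h\<close> is the Jacobi function divided by \<open>exp (\<i> l ln (cosh t))\<close>, and
  \<open>u = h' cosh\<close>; the Jacobi equation becomes a first order system for the two. The factor
  \<open>cosh\<close> removes the weight \<open>1 / cosh\<^sup>2\<close> from the potential term of the energy, which is what lets
  the terms in \<open>l\<^sup>2\<close> cancel.
\<close>

locale modulated_jacobi =
  fixes \<alpha> \<beta> l :: real and h u :: "real \<Rightarrow> complex"
  assumes \<alpha>: "\<alpha> > 0" and \<beta>: "\<beta> \<ge> - 1/2"
    and h_0: "h 0 = 1" and u_0: "u 0 = 0"
    and cont_u: "continuous_on {0..} u"
    and h_deriv: "\<And>t. t \<ge> 0 \<Longrightarrow> (h has_vector_derivative u t / of_real (cosh t)) (at t)"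
    and u_deriv: "\<And>t. t > 0 \<Longrightarrow> (u has_vector_derivative
      - (of_real ((2 * \<alpha> + 1) * cosh t / sinh t + 2 * \<beta> * sinh t / cosh t)
          + \<i> * of_real (2 * l * sinh t / cosh t)) * u t
      - (of_real (l\<^sup>2) - \<i> * of_real (2 * l * \<beta>)) / of_real (cosh t) * h t) (at t)"
begin

lemma cont_h: "continuous_on {0..} h"
proof (intro continuous_at_imp_continuous_on ballI)
  fix t :: real assume "t \<in> {0..}"
  then show "isCont h t"
    using has_vector_derivative_continuous[OF h_deriv] by simp
qed

text \<open>
  With \<open>W = 2 \<alpha> + 1 / cosh\<^sup>2\<close>, the remainder in the energy rate is at most \<open>- \<beta>\<^sup>2 W' / W\<close>
  times the energy. Hence the energy times \<open>W\<^bsup>\<beta>\<^sup>2\<^esup>\<close> is nonincreasing, and \<open>W\<close> only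
  falls from \<open>2 \<alpha> + 1\<close> towards \<open>2 \<alpha>\<close>.
\<close>

lemma energy_bound:
  assumes t: "t \<ge> 0" and l: "l \<noteq> 0"
  shows "(norm (h t))\<^sup>2 \<le> (1 + 1 / (2 * \<alpha>)) powr \<beta>\<^sup>2"
proof -
  define W where "W t = 2 * \<alpha> + 1 / (cosh t)\<^sup>2" for t :: real
  define E where "E t = u t \<bullet> u t + l\<^sup>2 * (h t \<bullet> h t)" for t
  have Wpos: "W x > 2 * \<alpha>" "W x > 0" for x
    using \<alpha> cosh_real_pos[of x] by (auto simp: W_def intro!: add_pos_pos)
  have contW: "continuous_on A W" for A
    unfolding W_def using cosh_real_pos by (intro continuous_intros) (auto simp: less_imp_neq[symmetric])
  have "E 0 * W 0 powr \<beta>\<^sup>2 \<ge> E t * W t powr \<beta>\<^sup>2"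
  proof (rule DERIV_nonpos_imp_decreasing_open[OF t])
    have "continuous_on {0..t} u" "continuous_on {0..t} h"
      using cont_u cont_h by (auto elim!: continuous_on_subset)
    then show "continuous_on {0..t} (\<lambda>t. E t * W t powr \<beta>\<^sup>2)"
      unfolding E_def using Wpos by (intro continuous_intros contW) (auto simp: less_imp_neq[symmetric])
    fix x assume x: "0 < x" "x < t"
    define S C where "S = sinh x" and "C = cosh x"
    have SC: "S > 0" "C > 0" "C\<^sup>2 = 1 + S\<^sup>2"
      using x by (auto simp: S_def C_def cosh_square_eq)
    define u' where "u' = - (of_real ((2 * \<alpha> + 1) * C / S + 2 * \<beta> * S / C)
          + \<i> * of_real (2 * l * S / C)) * u x
        - (of_real (l\<^sup>2) - \<i> * of_real (2 * l * \<beta>)) / of_real C * h x"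
    have du: "(u has_vector_derivative u') (at x)"
      unfolding u'_def S_def C_def by (rule u_deriv[OF x(1)])
    have dh: "(h has_vector_derivative u x / of_real C) (at x)"
      unfolding C_def using x by (intro h_deriv) auto
    have dE: "(E has_real_derivative (2 * (u x \<bullet> u') + 2 * l\<^sup>2 * (h x \<bullet> (u x / of_real C)))) (at x)"
    proof -
      have "(E has_real_derivative (u x \<bullet> u' + u' \<bullet> u x)
          + l\<^sup>2 * (h x \<bullet> (u x / of_real C) + (u x / of_real C) \<bullet> h x)) (at x)"
        unfolding E_def has_real_derivative_iff_has_vector_derivative
        by (intro has_vector_derivative_add has_vector_derivative_mult_right
            bounded_bilinear.has_vector_derivative[OF bounded_bilinear_inner] du dh)
      then show ?thesis by (simp add: inner_commute algebra_simps)
    qed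
    have dW: "(W has_real_derivative - 2 * S / C ^ 3) (at x)"
      unfolding W_def S_def C_def using cosh_real_pos[of x]
      by (auto intro!: derivative_eq_intros simp: field_simps power2_eq_square power3_eq_cube)
    have W_eq: "W x = 2 * \<alpha> + 1 / C\<^sup>2" by (simp add: W_def C_def)
    define E' where "E' = 2 * (u x \<bullet> u') + 2 * l\<^sup>2 * (h x \<bullet> (u x / of_real C))"
    have "E' \<le> 2 * \<beta>\<^sup>2 * (S / C ^ 3) / W x * (l\<^sup>2 * (norm (h x))\<^sup>2)"
      unfolding E'_def u'_def W_eq by (rule jacobi_energy_rate[OF \<alpha> \<beta> SC])
    also have "\<dots> \<le> 2 * \<beta>\<^sup>2 * (S / C ^ 3) / W x * E x"
      using SC Wpos[of x] unfolding E_def power2_norm_eq_inner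
      by (intro mult_left_mono) (auto intro!: divide_nonneg_nonneg mult_nonneg_nonneg)
    finally have "W x powr \<beta>\<^sup>2 * (E' - 2 * \<beta>\<^sup>2 * (S / C ^ 3) / W x * E x) \<le> 0"
      by (intro mult_nonneg_nonpos) auto
    moreover have "((\<lambda>t. E t * W t powr \<beta>\<^sup>2) has_real_derivative
        W x powr \<beta>\<^sup>2 * (E' - 2 * \<beta>\<^sup>2 * (S / C ^ 3) / W x * E x)) (at x)"
    proof -
      have dP: "((\<lambda>t. W t powr \<beta>\<^sup>2) has_real_derivative (W x powr \<beta>\<^sup>2 * (\<beta>\<^sup>2 * (- 2 * S / C ^ 3) / W x))) (at x)"
        using Wpos[of x] by (auto intro!: derivative_eq_intros dW simp: powr_diff mult_ac)
      show ?thesis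
        by (rule DERIV_cong[OF DERIV_mult[OF dE dP]]) (simp add: E'_def algebra_simps)
    qed
    ultimately show "\<exists>y. ((\<lambda>t. E t * W t powr \<beta>\<^sup>2) has_real_derivative y) (at x) \<and> y \<le> 0"
      by blast
  qed
  moreover have "E 0 = l\<^sup>2" by (simp add: E_def h_0 u_0 inner_complex_def)
  moreover have "W 0 = 2 * \<alpha> + 1" by (simp add: W_def)
  ultimately have "E t * W t powr \<beta>\<^sup>2 \<le> l\<^sup>2 * (2 * \<alpha> + 1) powr \<beta>\<^sup>2" by simp
  moreover have "l\<^sup>2 * (norm (h t))\<^sup>2 * (2 * \<alpha>) powr \<beta>\<^sup>2 \<le> E t * W t powr \<beta>\<^sup>2"
    unfolding E_def power2_norm_eq_inner using Wpos[of t] \<alpha>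
    by (intro mult_mono powr_mono2) auto
  ultimately have "l\<^sup>2 * ((norm (h t))\<^sup>2 * (2 * \<alpha>) powr \<beta>\<^sup>2) \<le> l\<^sup>2 * (2 * \<alpha> + 1) powr \<beta>\<^sup>2"
    by (simp add: mult.assoc)
  then have "(norm (h t))\<^sup>2 * (2 * \<alpha>) powr \<beta>\<^sup>2 \<le> (2 * \<alpha> + 1) powr \<beta>\<^sup>2"
    using l by simp
  then have "(norm (h t))\<^sup>2 \<le> (2 * \<alpha> + 1) powr \<beta>\<^sup>2 / (2 * \<alpha>) powr \<beta>\<^sup>2"
    using \<alpha> by (simp add: pos_le_divide_eq)
  also have "\<dots> = ((2 * \<alpha> + 1) / (2 * \<alpha>)) powr \<beta>\<^sup>2"
    using \<alpha> by (simp add: powr_divide)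
  also have "(2 * \<alpha> + 1) / (2 * \<alpha>) = 1 + 1 / (2 * \<alpha>)"
    using \<alpha> by (simp add: field_simps)
  finally show ?thesis .
qed

text \<open>
  The equation for \<^term>\<open>h\<close> has the zeroth order coefficient \<open>\<kappa> / cosh\<^sup>2\<close>.
\<close>

definition \<kappa> :: complex where "\<kappa> = of_real (l\<^sup>2) - \<i> * of_real (2 * l * \<beta>)"

text \<open>
  The coefficient of \<^term>\<open>u\<close> is removed by the integrating factor \<open>J\<close>, of modulus
  \<open>R = sinh\<^bsup>2 \<alpha> + 1\<^esup> cosh\<^bsup>2 \<beta>\<^esup>\<close>. Since \<open>R\<close> grows fast,
  \<open>(arctan \<circ> sinh) R\<close> has derivative at least \<open>(1 + 2 \<alpha>) R / cosh\<close>. This is where the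
  damping yields the factor \<open>1 / (1 + 2 \<alpha>)\<close>.
\<close>

lemma derivative_bound:
  assumes t: "t \<ge> 0" and K: "\<And>s. s \<ge> 0 \<Longrightarrow> norm (\<kappa> * h s) \<le> K"
  shows "norm (u t) \<le> K / (1 + 2 * \<alpha>) * arctan (sinh t)"
proof (cases "t = 0")
  case True
  then show ?thesis by (simp add: u_0)
next
  case False
  then have tpos: "t > 0" using t by simp
  define M where "M = K / (1 + 2 * \<alpha>)"
  have K0: "K \<ge> 0" using K[of 0] norm_ge_zero order_trans by blast
  have M0: "M \<ge> 0" unfolding M_def using K0 \<alpha> by simp
  define R where "R t = sinh t powr (2 * \<alpha> + 1) * cosh t powr (2 * \<beta>)" for t :: real
  \<comment> \<open>The phase of the integrating factor cancels the rotating part of the coefficient.\<close>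
  define \<omega> where "\<omega> t = exp (\<i> * of_real (2 * l * ln (cosh t)))" for t :: real
  define J where "J t = of_real (R t) * \<omega> t" for t
  have cont_R: "continuous_on {0..t} R"
    unfolding R_def using cosh_real_pos \<alpha>
    by (intro continuous_intros continuous_on_powr') (auto simp: less_imp_neq[symmetric] less_imp_le)
  have cont_\<omega>: "continuous_on {0..t} \<omega>"
    unfolding \<omega>_def using cosh_real_pos
    by (intro continuous_intros) (auto simp: less_imp_neq[symmetric])
  have "norm (u t * J t - u 0 * J 0) \<le> M * (arctan (sinh t) * R t) - M * (arctan (sinh 0) * R 0)"
  proof (rule differentiable_bound_general[OF tpos,
      where f = "\<lambda>t. u t * J t" and \<phi> = "\<lambda>t. M * (arctan (sinh t) * R t)"])
    show "continuous_on {0..t} (\<lambda>t. u t * J t)"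
      unfolding J_def
      by (intro continuous_on_mult continuous_on_of_real cont_R cont_\<omega> continuous_on_subset[OF cont_u]) auto
    show "continuous_on {0..t} (\<lambda>t. M * (arctan (sinh t) * R t))"
      by (intro continuous_intros cont_R)
    fix x :: real assume x: "0 < x" "x < t"
    define S C where "S = sinh x" and "C = cosh x"
    have SC: "S > 0" "C > 0" "C\<^sup>2 = 1 + S\<^sup>2"
      using x by (auto simp: S_def C_def cosh_square_eq)
    define D where "D = (2 * \<alpha> + 1) * C / S + 2 * \<beta> * S / C"
    define \<theta> where "\<theta> = 2 * l * S / C"
    have Rpos: "R x > 0" using SC by (simp add: R_def S_def C_def)
    have dR: "(R has_real_derivative R x * D) (at x)"
    proof -
      have "((\<lambda>t. sinh t powr (2 * \<alpha> + 1)) has_real_derivative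
          S powr (2 * \<alpha> + 1) * ((2 * \<alpha> + 1) * C / S)) (at x)"
      proof (rule DERIV_cong)
        show "((\<lambda>t. sinh t powr (2 * \<alpha> + 1)) has_real_derivative
            (2 * \<alpha> + 1) * S powr (2 * \<alpha> + 1 - 1) * C) (at x)"
          unfolding S_def C_def using SC(1)
          by (intro DERIV_chain2[OF has_real_derivative_powr])
             (auto simp: S_def intro!: derivative_eq_intros)
        show "(2 * \<alpha> + 1) * S powr (2 * \<alpha> + 1 - 1) * C
            = S powr (2 * \<alpha> + 1) * ((2 * \<alpha> + 1) * C / S)"
          using SC(1) by (simp add: powr_add)
      qed
      moreover have "((\<lambda>t. cosh t powr (2 * \<beta>)) has_real_derivative
          C powr (2 * \<beta>) * (2 * \<beta> * S / C)) (at x)"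
        using SC unfolding S_def C_def by (auto intro!: derivative_eq_intros simp: powr_diff)
      ultimately show ?thesis
        unfolding R_def
        by (rule DERIV_cong[OF DERIV_mult]) (simp add: D_def S_def C_def algebra_simps)
    qed
    have d\<omega>: "(\<omega> has_vector_derivative \<i> * of_real \<theta> * \<omega> x) (at x)"
    proof -
      have "((\<lambda>t. 2 * l * ln (cosh t)) has_real_derivative \<theta>) (at x)"
        using SC unfolding \<theta>_def S_def C_def by (auto intro!: derivative_eq_intros simp: field_simps)
      then have "((\<lambda>t. complex_of_real (2 * l * ln (cosh t))) has_vector_derivative of_real \<theta>) (at x)"
        by (simp only: has_real_derivative_iff_has_vector_derivative has_vector_derivative_of_real)
      then have "((\<lambda>t. \<i> * complex_of_real (2 * l * ln (cosh t))) has_vector_derivative \<i> * of_real \<theta>) (at x)"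
        by (rule has_vector_derivative_mult_right)
      from field_vector_diff_chain_at[OF this DERIV_exp]
      show ?thesis unfolding \<omega>_def by (simp add: o_def)
    qed
    have dJ: "(J has_vector_derivative (of_real D + \<i> * of_real \<theta>) * J x) (at x)"
    proof -
      have "((\<lambda>t. complex_of_real (R t)) has_vector_derivative of_real (R x * D)) (at x)"
        using dR by (simp only: has_real_derivative_iff_has_vector_derivative has_vector_derivative_of_real)
      from has_vector_derivative_mult[OF this d\<omega>] show ?thesis
        unfolding J_def by (simp add: algebra_simps)
    qed
    have "(u has_vector_derivative
        - (of_real D + \<i> * of_real \<theta>) * u x - \<kappa> / of_real C * h x) (at x)"
      unfolding D_def \<theta>_def S_def C_def \<kappa>_def by (rule u_deriv[OF x(1)])
    from has_vector_derivative_mult[OF this dJ]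
    show "((\<lambda>t. u t * J t) has_vector_derivative - (\<kappa> * h x) / of_real C * J x) (at x)"
      by (simp add: algebra_simps)
    show "((\<lambda>t. M * (arctan (sinh t) * R t)) has_vector_derivative
        M * (R x * (1 / C + arctan S * D))) (at x)"
      unfolding has_real_derivative_iff_has_vector_derivative[symmetric]
      by (rule DERIV_cong[OF DERIV_cmult[OF DERIV_mult[OF gudermannian_deriv dR]]])
         (simp add: S_def C_def algebra_simps)
    have "(1 + 2 * \<alpha>) / C \<le> 1 / C + arctan S * D"
    proof -
      have "C \<ge> 1" using cosh_real_ge_1[of x] by (simp add: C_def)
      have "2 * \<alpha> / C \<le> 2 * \<alpha> * 1"
        using \<open>C \<ge> 1\<close> \<alpha> by (simp add: field_simps)
      also have "\<dots> = S / C * (2 * \<alpha> * (C / S))"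
        using SC by simp
      also have "\<dots> \<le> arctan S * D"
      proof (rule mult_mono)
        show "S / C \<le> arctan S"
          using tanh_le_gudermannian[of x] x by (simp add: S_def C_def)
        have "S / C \<le> C / S"
          using SC by (simp add: field_simps power2_eq_square)
        moreover have "- (S / C) \<le> 2 * \<beta> * (S / C)"
          using mult_right_mono[of "- 1" "2 * \<beta>" "S / C"] \<beta> SC by simp
        ultimately have "0 \<le> C / S + 2 * \<beta> * (S / C)" by linarith
        then show "2 * \<alpha> * (C / S) \<le> D"
          unfolding D_def by (simp add: distrib_right add_divide_distrib)
      qed (use SC \<alpha> in auto)
      finally show ?thesis by (simp add: add_divide_distrib)
    qed
    then have "K / C \<le> M * (1 / C + arctan S * D)"
    proof -
      assume *: "(1 + 2 * \<alpha>) / C \<le> 1 / C + arctan S * D"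
      have "K / C = M * ((1 + 2 * \<alpha>) / C)" using \<alpha> by (simp add: M_def)
      also have "\<dots> \<le> M * (1 / C + arctan S * D)" by (rule mult_left_mono[OF * M0])
      finally show ?thesis .
    qed
    moreover have "norm (- (\<kappa> * h x) / of_real C * J x) \<le> K / C * R x"
    proof -
      have "norm (J x) = R x" using Rpos by (simp add: J_def \<omega>_def norm_mult)
      then have "norm (- (\<kappa> * h x) / of_real C * J x) = norm (\<kappa> * h x) / C * R x"
        using SC by (simp add: norm_mult norm_divide)
      also have "\<dots> \<le> K / C * R x"
        using K[of x] x SC Rpos by (intro mult_right_mono divide_right_mono) auto
      finally show ?thesis .
    qed
    ultimately show "norm (- (\<kappa> * h x) / of_real C * J x) \<le> M * (R x * (1 / C + arctan S * D))"
    proof -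
      assume K: "K / C \<le> M * (1 / C + arctan S * D)"
        and n: "norm (- (\<kappa> * h x) / of_real C * J x) \<le> K / C * R x"
      have "K / C * R x \<le> M * (1 / C + arctan S * D) * R x"
        using K Rpos by (intro mult_right_mono) auto
      with n show ?thesis by (simp only: mult_ac)
    qed
  qed
  then have "norm (u t) * R t \<le> M * arctan (sinh t) * R t"
    using tpos by (simp add: u_0 J_def \<omega>_def norm_mult R_def mult.assoc)
  moreover have "R t > 0" using tpos by (simp add: R_def)
  ultimately have "norm (u t) \<le> M * arctan (sinh t)" by (rule mult_right_le_imp_le)
  then show ?thesis unfolding M_def .
qed

lemma deviation_bound:
  assumes t: "t \<ge> 0" and K: "\<And>s. s \<ge> 0 \<Longrightarrow> norm (\<kappa> * h s) \<le> K"
  shows "norm (h t - 1) \<le> 2 * K * (min 1 t)\<^sup>2 / (1 + 2 * \<alpha>)"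
proof (cases "t = 0")
  case True
  then show ?thesis by (simp add: h_0)
next
  case False
  then have tpos: "t > 0" using t by simp
  define M where "M = K / (1 + 2 * \<alpha>)"
  have K0: "K \<ge> 0" using K[of 0] norm_ge_zero order_trans by blast
  have M0: "M \<ge> 0" unfolding M_def using K0 \<alpha> by simp
  have "norm (h t - h 0) \<le> M / 2 * (arctan (sinh t))\<^sup>2 - M / 2 * (arctan (sinh 0))\<^sup>2"
  proof (rule differentiable_bound_general[OF tpos,
      where \<phi> = "\<lambda>t. M / 2 * (arctan (sinh t))\<^sup>2"])
    show "continuous_on {0..t} h"
      by (rule continuous_on_subset[OF cont_h]) auto
    show "continuous_on {0..t} (\<lambda>t. M / 2 * (arctan (sinh t))\<^sup>2)"
      by (intro continuous_intros)
    fix x :: real assume x: "0 < x" "x < t"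
    show "(h has_vector_derivative u x / of_real (cosh x)) (at x)"
      using x by (intro h_deriv) auto
    \<comment> \<open>As \<open>\<bar>h'\<bar> = \<bar>u\<bar> / cosh\<close>, the bound on \<open>u\<close> is the derivative of a squared Gudermannian.\<close>
    show "((\<lambda>t. M / 2 * (arctan (sinh t))\<^sup>2) has_vector_derivative M * arctan (sinh x) / cosh x) (at x)"
      unfolding has_real_derivative_iff_has_vector_derivative[symmetric]
      by (auto intro!: derivative_eq_intros gudermannian_deriv[THEN DERIV_cong])
    show "norm (u x / of_real (cosh x)) \<le> M * arctan (sinh x) / cosh x"
    proof -
      have "norm (u x) \<le> M * arctan (sinh x)"
        unfolding M_def using x by (intro derivative_bound K) auto
      then show ?thesis
        using cosh_real_pos[of x] by (simp add: norm_divide divide_right_mono)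
    qed
  qed
  also have "\<dots> = M / 2 * (arctan (sinh t))\<^sup>2" by simp
  also have "\<dots> \<le> M / 2 * (2 * min 1 t)\<^sup>2"
    using M0 gudermannian_le[OF t] t
    by (intro mult_left_mono power_mono) auto
  also have "\<dots> = 2 * K * (min 1 t)\<^sup>2 / (1 + 2 * \<alpha>)"
    unfolding M_def using \<alpha> by (simp add: power_mult_distrib field_simps)
  finally show ?thesis by (simp add: h_0)
qed

end

section \<open>Jacobi functions as modulated systems\<close>

text \<open>
  The computation behind the equation for \<open>u\<close>, with \<open>C\<close> and \<open>S\<close> for \<open>cosh t\<close> and \<open>sinh t\<close>,
  \<open>F\<close>, \<open>F1\<close>, \<open>F2\<close> for the hypergeometric function and its derivatives at \<open>- S\<^sup>2\<close>, \<open>il\<close> for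
  \<open>\<i> l\<close>, and \<open>X\<close> for \<open>u / S\<close> without its phase. The left-hand side comes from the product and
  chain rules.
\<close>

lemma jacobi_derivative_identity:
  fixes C S F F1 F2 il \<rho> \<alpha> \<beta> :: complex
  assumes C: "C \<noteq> 0" "C\<^sup>2 = 1 + S\<^sup>2" and S: "S \<noteq> 0"
    and \<rho>: "\<rho> = \<alpha> + \<beta> + 1"
    and ode: "- S\<^sup>2 * C\<^sup>2 * F2 + (\<alpha> + 1 + (\<rho> + 1) * S\<^sup>2) * F1 - (\<rho> + il / 2) * (- il / 2) * F = 0"
  defines "X \<equiv> - 2 * C\<^sup>2 * F1 - il * F"
  shows "- il * (S / C) * (S * X)
      + (C * X + S * (- 4 * C * S * F1 + 4 * S * C ^ 3 * F2 + 2 * il * S * C * F1))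
    = - ((2 * \<alpha> + 1) * C / S + 2 * \<beta> * S / C + 2 * il * S / C) * (S * X)
      - (- (il\<^sup>2) - 2 * il * \<beta>) / C * F" (is "?L = ?R")
proof -
  define k where "k = il / 2"
  have il: "il = 2 * k" by (simp add: k_def)
  have "C * ?L = - il * S\<^sup>2 * X + C\<^sup>2 * X - 4 * C\<^sup>2 * S\<^sup>2 * F1 + 4 * C\<^sup>2 * (S\<^sup>2 * C\<^sup>2 * F2)
      + 2 * il * S\<^sup>2 * C\<^sup>2 * F1"
    using C(1) by (simp add: field_simps power2_eq_square power3_eq_cube)
  also have "S\<^sup>2 * C\<^sup>2 * F2 = (\<alpha> + 1 + (\<rho> + 1) * S\<^sup>2) * F1 + (\<rho> + k) * k * F"
    using ode unfolding il by (simp add: algebra_simps)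
  also have "- il * S\<^sup>2 * X + C\<^sup>2 * X - 4 * C\<^sup>2 * S\<^sup>2 * F1
      + 4 * C\<^sup>2 * ((\<alpha> + 1 + (\<rho> + 1) * S\<^sup>2) * F1 + (\<rho> + k) * k * F)
      + 2 * il * S\<^sup>2 * C\<^sup>2 * F1
    = - ((2 * \<alpha> + 1) * C\<^sup>2 + (2 * \<beta> + 2 * il) * S\<^sup>2) * X + (il\<^sup>2 + 2 * il * \<beta>) * F"
    unfolding X_def C(2) \<rho> il by algebra
  also have "\<dots> = C * ?R"
    using C(1) S by (simp add: field_simps power2_eq_square)
  finally show ?thesis using C(1) by simp
qed

text \<open>
  The continuation \<open>F\<close> along \<open>z = - sinh\<^sup>2 t\<close>, divided by the oscillation, is \<open>h\<close>. Writing
  \<open>u = h' cosh\<close> out through \<open>F\<close> and its derivative makes it visibly smooth at \<open>0\<close>, where the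
  equation for \<open>u\<close> is singular.
\<close>

lemma jacobi_fun_modulated:
  fixes \<alpha> \<beta> l :: real
  assumes \<alpha>: "\<alpha> > 0" and \<beta>: "\<beta> \<ge> - 1/2"
  obtains h u where "modulated_jacobi \<alpha> \<beta> l h u"
    "\<And>t. jacobi_fun \<alpha> \<beta> (\<i> * of_real (\<alpha> + \<beta> + 1) - of_real l) t
        = exp (\<i> * of_real l * of_real (ln (cosh t))) * h t"
proof -
  define a b c :: complex where "a = of_real (\<alpha> + \<beta> + 1) + \<i> * of_real l / 2"
    and "b = - (\<i> * of_real l / 2)" and "c = of_real (\<alpha> + 1)"
  have c: "c \<notin> \<int>\<^sub>\<le>\<^sub>0"
    by (rule Re_pos_imp_not_nonpos_Int) (use \<alpha> in \<open>simp add: c_def\<close>)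
  have "Re b > - 1" "Re (c - b) > 1"
    using \<alpha> by (auto simp: b_def c_def)
  from hyp2f1_continuation_exists[OF this, of a]
  obtain F where F: "hyp2f1_continuation a b c F" by (rule exE)
  have hol: "F holomorphic_on slit_plane"
    using F by (simp only: hyp2f1_continuation_def)
  define z where "z t = - ((complex_of_real (sinh t))\<^sup>2)" for t
  have z_slit: "z t \<in> slit_plane" for t
  proof -
    have "1 - z t = of_real (1 + (sinh t)\<^sup>2)" by (simp add: z_def)
    moreover have "1 + (sinh t)\<^sup>2 > 0" by (simp add: add_pos_nonneg)
    ultimately show ?thesis
      unfolding slit_plane_iff by (simp add: complex_nonpos_Reals_iff del: of_real_add)
  qed
  define e where "e t = exp (- (\<i> * of_real l * of_real (ln (cosh t))))" for t :: real
  define X where "X t = - 2 * (complex_of_real (cosh t))\<^sup>2 * deriv F (z t) - \<i> * of_real l * F (z t)" for t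
  define h where "h t = e t * F (z t)" for t
  define u where "u t = e t * (of_real (sinh t) * X t)" for t
  have dz: "(z has_vector_derivative - 2 * of_real (sinh t) * of_real (cosh t)) (at t)" for t
  proof -
    have "((\<lambda>t. - ((sinh t)\<^sup>2)) has_real_derivative - 2 * sinh t * cosh t) (at t)"
      by (auto intro!: derivative_eq_intros)
    then have "((\<lambda>t. complex_of_real (- ((sinh t)\<^sup>2))) has_vector_derivative
        of_real (- 2 * sinh t * cosh t)) (at t)"
      by (simp only: has_real_derivative_iff_has_vector_derivative has_vector_derivative_of_real)
    then show ?thesis by (simp add: z_def[abs_def])
  qed
  have hol': "deriv F holomorphic_on slit_plane"
    by (intro holomorphic_deriv hol open_slit_plane)
  have dcomp: "((\<lambda>t. G (z t)) has_vector_derivative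
      - 2 * of_real (sinh t) * of_real (cosh t) * deriv G (z t)) (at t)"
    if "G holomorphic_on slit_plane" for G t
    using field_vector_diff_chain_at[OF dz holomorphic_derivI[OF that open_slit_plane z_slit]]
    by (simp add: o_def)
  have de: "(e has_vector_derivative - (\<i> * of_real l) * of_real (sinh t / cosh t) * e t) (at t)" for t
  proof -
    have "((\<lambda>t. ln (cosh t)) has_real_derivative sinh t / cosh t) (at t)"
      using cosh_real_pos[of t] by (auto intro!: derivative_eq_intros)
    then have "((\<lambda>t. complex_of_real (ln (cosh t))) has_vector_derivative of_real (sinh t / cosh t)) (at t)"
      by (simp only: has_real_derivative_iff_has_vector_derivative has_vector_derivative_of_real)
    then have "((\<lambda>t. - (\<i> * of_real l) * complex_of_real (ln (cosh t))) has_vector_derivative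
        - (\<i> * of_real l) * of_real (sinh t / cosh t)) (at t)"
      by (rule has_vector_derivative_mult_right)
    from field_vector_diff_chain_at[OF this DERIV_exp]
    show ?thesis unfolding e_def by (simp add: o_def)
  qed
  have dS: "((\<lambda>t. complex_of_real (sinh t)) has_vector_derivative of_real (cosh t)) (at t)" for t :: real
  proof -
    have "(sinh has_real_derivative cosh t) (at t)" by (auto intro!: derivative_eq_intros)
    then show ?thesis
      by (simp only: has_real_derivative_iff_has_vector_derivative has_vector_derivative_of_real)
  qed
  have dX: "(X has_vector_derivative
      (- 4 * of_real (cosh t) * of_real (sinh t) * deriv F (z t)
       + 4 * of_real (sinh t) * of_real (cosh t) ^ 3 * deriv (deriv F) (z t)
       + 2 * (\<i> * of_real l) * of_real (sinh t) * of_real (cosh t) * deriv F (z t))) (at t)" for t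
  proof -
    have "((\<lambda>t. - 2 * (cosh t)\<^sup>2) has_real_derivative - 4 * cosh t * sinh t) (at t)"
      by (auto intro!: derivative_eq_intros)
    then have "((\<lambda>t. complex_of_real (- 2 * (cosh t)\<^sup>2)) has_vector_derivative
        of_real (- 4 * cosh t * sinh t)) (at t)"
      by (simp only: has_real_derivative_iff_has_vector_derivative has_vector_derivative_of_real)
    note d = has_vector_derivative_diff[OF has_vector_derivative_mult[OF this dcomp[OF hol']]
        has_vector_derivative_mult_right[OF dcomp[OF hol], of "\<i> * of_real l"]]
    have "X = (\<lambda>t. of_real (- 2 * (cosh t)\<^sup>2) * deriv F (z t) - \<i> * of_real l * F (z t))"
      by (simp add: X_def fun_eq_iff)
    then show ?thesis
      by (simp only:) (rule has_vector_derivative_eq_rhs[OF d],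
        simp add: algebra_simps power2_eq_square power3_eq_cube)
  qed
  have du: "(u has_vector_derivative
      e t * (- (\<i> * of_real l) * (of_real (sinh t) / of_real (cosh t)) * (of_real (sinh t) * X t)
      + (of_real (cosh t) * X t + of_real (sinh t) *
       (- 4 * of_real (cosh t) * of_real (sinh t) * deriv F (z t)
       + 4 * of_real (sinh t) * of_real (cosh t) ^ 3 * deriv (deriv F) (z t)
       + 2 * (\<i> * of_real l) * of_real (sinh t) * of_real (cosh t) * deriv F (z t))))) (at t)" for t
    unfolding u_def
    by (rule has_vector_derivative_eq_rhs[OF has_vector_derivative_mult[OF de has_vector_derivative_mult[OF dS dX]]])
       (simp add: algebra_simps)
  have "modulated_jacobi \<alpha> \<beta> l h u"
  proof
    have "F 0 = 1"
    proof -
      have "F 0 = eval_fps (fps_hypergeo [a, b] [c] 1) 0"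
        using F unfolding hyp2f1_continuation_def by (metis centre_in_ball zero_less_one)
      then show ?thesis by (simp add: eval_fps_at_0)
    qed
    then show "h 0 = 1" by (simp add: h_def e_def z_def)
    show "u 0 = 0" by (simp add: u_def)
    show "continuous_on {0..} u"
      by (intro continuous_at_imp_continuous_on ballI has_vector_derivative_continuous[OF du])
    fix t :: real
    have "(h has_vector_derivative e t * (- 2 * of_real (sinh t) * of_real (cosh t) * deriv F (z t))
        + - (\<i> * of_real l) * of_real (sinh t / cosh t) * e t * F (z t)) (at t)"
      unfolding h_def by (rule has_vector_derivative_mult[OF de dcomp[OF hol]])
    also have "e t * (- 2 * of_real (sinh t) * of_real (cosh t) * deriv F (z t))
        + - (\<i> * of_real l) * of_real (sinh t / cosh t) * e t * F (z t) = u t / of_real (cosh t)"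
      using cosh_real_pos[of t] by (simp add: u_def X_def field_simps power2_eq_square)
    finally show "(h has_vector_derivative u t / of_real (cosh t)) (at t)" .
    assume t: "t > 0"
    define C S where "C = complex_of_real (cosh t)" and "S = complex_of_real (sinh t)"
    have CS: "C \<noteq> 0" "C\<^sup>2 = 1 + S\<^sup>2" "S \<noteq> 0"
      using t by (auto simp: C_def S_def cosh_square_eq simp flip: of_real_power)
    have ode: "- S\<^sup>2 * C\<^sup>2 * deriv (deriv F) (z t)
        + (of_real \<alpha> + 1 + (of_real (\<alpha> + \<beta> + 1) + 1) * S\<^sup>2) * deriv F (z t)
        - (of_real (\<alpha> + \<beta> + 1) + \<i> * of_real l / 2) * (- (\<i> * of_real l) / 2) * F (z t) = 0"
      using hyp2f1_continuation_ode[OF c F z_slit[of t]]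
      unfolding CS(2) by (simp add: z_def S_def[symmetric] a_def b_def c_def algebra_simps)
    have \<rho>: "complex_of_real (\<alpha> + \<beta> + 1) = of_real \<alpha> + of_real \<beta> + 1" by simp
    note jacobi_derivative_identity[OF CS(1,2,3) \<rho> ode]
    then have "e t * (- (\<i> * of_real l) * (S / C) * (S * X t)
      + (C * X t + S * (- 4 * C * S * deriv F (z t) + 4 * S * C ^ 3 * deriv (deriv F) (z t)
         + 2 * (\<i> * of_real l) * S * C * deriv F (z t))))
      = e t * (- ((2 * of_real \<alpha> + 1) * C / S + 2 * of_real \<beta> * S / C + 2 * (\<i> * of_real l) * S / C) * (S * X t)
      - (- ((\<i> * of_real l)\<^sup>2) - 2 * (\<i> * of_real l) * of_real \<beta>) / C * F (z t))"
      unfolding X_def C_def[symmetric] by simp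
    also have "\<dots> = - (of_real ((2 * \<alpha> + 1) * cosh t / sinh t + 2 * \<beta> * sinh t / cosh t)
          + \<i> * of_real (2 * l * sinh t / cosh t)) * u t
      - (of_real (l\<^sup>2) - \<i> * of_real (2 * l * \<beta>)) / of_real (cosh t) * h t"
      by (simp add: u_def h_def C_def S_def power_mult_distrib algebra_simps)
    finally show "(u has_vector_derivative
      - (of_real ((2 * \<alpha> + 1) * cosh t / sinh t + 2 * \<beta> * sinh t / cosh t)
          + \<i> * of_real (2 * l * sinh t / cosh t)) * u t
      - (of_real (l\<^sup>2) - \<i> * of_real (2 * l * \<beta>)) / of_real (cosh t) * h t) (at t)"
      using du[of t] unfolding C_def S_def by simp
  qed (rule \<alpha> \<beta>)+
  moreover have "jacobi_fun \<alpha> \<beta> (\<i> * of_real (\<alpha> + \<beta> + 1) - of_real l) t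
      = exp (\<i> * of_real l * of_real (ln (cosh t))) * h t" for t
  proof -
    have ab: "(of_real (\<alpha> + \<beta> + 1) - \<i> * (\<i> * of_real (\<alpha> + \<beta> + 1) - of_real l)) / 2 = a"
      "(of_real (\<alpha> + \<beta> + 1) + \<i> * (\<i> * of_real (\<alpha> + \<beta> + 1) - of_real l)) / 2 = b"
      by (simp_all add: a_def b_def field_simps)
    have zt: "complex_of_real (- ((sinh t)\<^sup>2)) = z t" by (simp add: z_def)
    have "jacobi_fun \<alpha> \<beta> (\<i> * of_real (\<alpha> + \<beta> + 1) - of_real l) t = F (z t)"
      unfolding jacobi_fun_def ab zt c_def[symmetric] by (rule hyp2f1_eqI[OF F z_slit])
    then show ?thesis by (simp add: h_def e_def flip: mult.assoc exp_add)
  qed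
  ultimately show ?thesis by (rule that)
qed

section \<open>The uniform estimate\<close>

text \<open>
  If \<open>\<bar>\<beta>\<bar> \<le> \<alpha>\<close>, the energy bound is at most \<open>exp (\<beta>\<^sup>2 / (2 \<alpha>)) \<le> exp \<bar>\<beta>\<bar>\<close>. Otherwise
  \<^term>\<open>\<beta>\<close> is negative, so \<open>\<beta>\<^sup>2 \<le> 1\<close>, and the energy bound is at most \<open>1 + 1 / (2 \<alpha>)\<close>. The
  blow-up at \<open>\<alpha> = 0\<close> is at most of order \<open>\<alpha>\<^bsup>-1/2\<^esup>\<close> for \<^term>\<open>norm (h t)\<close>, which the
  estimate of the deviation can afford.
\<close>

lemma (in modulated_jacobi) uniform_bound:
  assumes \<beta>\<alpha>: "\<beta> < \<alpha>" and t: "t \<ge> 0" and l: "l \<noteq> 0"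
  shows "norm (h t) \<le> exp (\<bar>\<beta>\<bar> / 2) * sqrt (1 + 1 / (2 * \<alpha>))"
proof -
  have "(norm (h t))\<^sup>2 \<le> (1 + 1 / (2 * \<alpha>)) powr \<beta>\<^sup>2"
    by (rule energy_bound[OF t l])
  also have "\<dots> \<le> exp \<bar>\<beta>\<bar> * (1 + 1 / (2 * \<alpha>))"
  proof (cases "\<bar>\<beta>\<bar> \<le> \<alpha>")
    case True
    have pos: "1 + 1 / (2 * \<alpha>) > 0" using \<alpha> by (simp add: add_pos_pos)
    have "\<beta>\<^sup>2 = \<bar>\<beta>\<bar> * \<bar>\<beta>\<bar>" by (simp add: power2_eq_square)
    also have "\<dots> \<le> \<bar>\<beta>\<bar> * \<alpha>" by (rule mult_left_mono[OF True]) simp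
    finally have sq: "\<beta>\<^sup>2 \<le> \<bar>\<beta>\<bar> * \<alpha>" .
    have "\<beta>\<^sup>2 * ln (1 + 1 / (2 * \<alpha>)) \<le> \<beta>\<^sup>2 * (1 / (2 * \<alpha>))"
      using \<alpha> by (intro mult_left_mono ln_add_one_self_le_self) auto
    also have "\<dots> \<le> (\<bar>\<beta>\<bar> * \<alpha>) * (1 / (2 * \<alpha>))"
      using sq \<alpha> by (intro mult_right_mono) auto
    also have "\<dots> \<le> \<bar>\<beta>\<bar>" using \<alpha> by simp
    finally have "(1 + 1 / (2 * \<alpha>)) powr \<beta>\<^sup>2 \<le> exp \<bar>\<beta>\<bar> * 1"
      using pos by (simp add: powr_def)
    also have "\<dots> \<le> exp \<bar>\<beta>\<bar> * (1 + 1 / (2 * \<alpha>))"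
      using \<alpha> by (intro mult_left_mono) auto
    finally show ?thesis .
  next
    case False
    then have "\<bar>\<beta>\<bar> \<le> 1" using \<beta>\<alpha> \<beta> \<alpha> by linarith
    then have "\<beta>\<^sup>2 \<le> 1" by (simp add: abs_square_le_1)
    then have "(1 + 1 / (2 * \<alpha>)) powr \<beta>\<^sup>2 \<le> (1 + 1 / (2 * \<alpha>)) powr 1"
      using \<alpha> by (intro powr_mono) auto
    also have "\<dots> = 1 * (1 + 1 / (2 * \<alpha>))" using \<alpha> by (simp add: add_pos_pos less_imp_le)
    also have "\<dots> \<le> exp \<bar>\<beta>\<bar> * (1 + 1 / (2 * \<alpha>))"
      using \<alpha> by (intro mult_right_mono) (auto simp: add_nonneg_nonneg)
    finally show ?thesis .
  qed
  also have "\<dots> = (exp (\<bar>\<beta>\<bar> / 2) * sqrt (1 + 1 / (2 * \<alpha>)))\<^sup>2"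
  proof -
    have "(exp (\<bar>\<beta>\<bar> / 2))\<^sup>2 = exp \<bar>\<beta>\<bar>"
      by (simp add: power2_eq_square flip: exp_add)
    then show ?thesis using \<alpha> by (simp add: power_mult_distrib)
  qed
  finally show ?thesis
    using \<alpha> by (auto intro: power2_le_imp_le)
qed

text \<open>
  With \<open>p = \<bar>l\<bar> min 1 t\<close> and \<open>r\<^sup>2 = 1 + 2 \<alpha>\<close>, the deviation is bounded both by a multiple of
  \<open>K (p\<^sup>2 + p) / r\<^sup>2\<close> and by \<open>2 K\<close>. The first is of order \<open>K p / r\<close> when \<open>p \<le> r\<close>, the second
  when \<open>p \<ge> r\<close>, and \<open>K / r\<close> is of order \<open>\<alpha>\<^bsup>-1/2\<^esup>\<close>.
\<close>

lemma (in modulated_jacobi) deviation_estimate: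
  assumes \<beta>\<alpha>: "\<beta> < \<alpha>" and t: "t \<ge> 0"
  shows "norm (h t - 1) \<le> 2 * exp (\<bar>\<beta>\<bar> / 2) * (1 + 2 * \<bar>\<beta>\<bar>) * (\<bar>l\<bar> * min 1 t / sqrt \<alpha>)"
proof (cases "l = 0")
  case True
  then have "\<kappa> = 0" unfolding \<kappa>_def by simp
  then have "norm (h t - 1) \<le> 2 * 0 * (min 1 t)\<^sup>2 / (1 + 2 * \<alpha>)"
    by (intro deviation_bound t) simp
  then show ?thesis using True by simp
next
  case False
  define m p r where "m = min 1 t" and "p = \<bar>l\<bar> * m" and "r = sqrt (1 + 2 * \<alpha>)"
  define A where "A = exp (\<bar>\<beta>\<bar> / 2)"
  define K where "K = A * (r / sqrt (2 * \<alpha>))"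
  have m: "0 \<le> m" "m \<le> 1" using t by (auto simp: m_def)
  have p0: "p \<ge> 0" using m by (simp add: p_def)
  have r: "r \<ge> 1" "r\<^sup>2 = 1 + 2 * \<alpha>" using \<alpha> by (auto simp: r_def)
  have A: "A \<ge> 1" by (simp add: A_def)
  \<comment> \<open>Written this way, \<open>K / r\<close> is visibly a multiple of \<open>1 / sqrt (2 \<alpha>)\<close>.\<close>
  have "sqrt (1 + 1 / (2 * \<alpha>)) = r / sqrt (2 * \<alpha>)"
    using \<alpha> by (simp add: r_def field_simps flip: real_sqrt_divide)
  then have hK: "norm (h s) \<le> K" if "s \<ge> 0" for s
    using uniform_bound[OF \<beta>\<alpha> that False] by (simp add: K_def A_def)
  have K1: "K \<ge> 1" using hK[of 0] by (simp add: h_0)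
  have \<kappa>: "norm \<kappa> \<le> l\<^sup>2 + 2 * \<bar>\<beta>\<bar> * \<bar>l\<bar>"
    unfolding \<kappa>_def by (rule order_trans[OF norm_triangle_ineq4]) (simp add: norm_mult norm_power abs_mult)
  have main: "norm (h t - 1) \<le> 2 * K * (1 + 2 * \<bar>\<beta>\<bar>) * (p / r)"
  proof (cases "p \<le> r")
    case True
    have "norm (\<kappa> * h s) \<le> (l\<^sup>2 + 2 * \<bar>\<beta>\<bar> * \<bar>l\<bar>) * K" if "s \<ge> 0" for s
      unfolding norm_mult using \<kappa> hK[OF that] by (intro mult_mono) auto
    from deviation_bound[OF t this]
    have "norm (h t - 1) \<le> 2 * ((l\<^sup>2 + 2 * \<bar>\<beta>\<bar> * \<bar>l\<bar>) * K) * m\<^sup>2 / r\<^sup>2"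
      by (simp add: m_def r(2))
    also have "\<dots> = 2 * K * ((p * p + 2 * \<bar>\<beta>\<bar> * (p * m)) / r\<^sup>2)"
      by (simp add: p_def power2_eq_square algebra_simps)
    also have "\<dots> \<le> 2 * K * ((p * r + 2 * \<bar>\<beta>\<bar> * (p * r)) / r\<^sup>2)"
      using True p0 m r(1) K1
      by (intro mult_left_mono divide_right_mono add_mono) auto
    also have "\<dots> = 2 * K * (1 + 2 * \<bar>\<beta>\<bar>) * (p / r)"
      using r(1) by (simp add: power2_eq_square field_simps)
    finally show ?thesis .
  next
    case False
    have "norm (h t - 1) \<le> norm (h t) + 1"
      using norm_triangle_ineq4[of "h t" 1] by simp
    also have "\<dots> \<le> 2 * K * 1 * 1" using hK[OF t] K1 by simp
    also have "\<dots> \<le> 2 * K * (1 + 2 * \<bar>\<beta>\<bar>) * (p / r)"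
      using False K1 r(1) by (intro mult_mono) auto
    finally show ?thesis .
  qed
  also have "2 * K * (1 + 2 * \<bar>\<beta>\<bar>) * (p / r) = 2 * A * (1 + 2 * \<bar>\<beta>\<bar>) * (p / sqrt (2 * \<alpha>))"
    using r(1) by (simp add: K_def)
  also have "\<dots> \<le> 2 * A * (1 + 2 * \<bar>\<beta>\<bar>) * (p / sqrt \<alpha>)"
    using \<alpha> A p0 by (intro mult_left_mono divide_left_mono) auto
  finally show ?thesis by (simp add: A_def p_def m_def)
qed

theorem proposition2p1:
  fixes \<beta> :: real
  assumes "\<beta> \<ge> - 1 / 2"
  shows "\<exists>C::real. \<forall>t\<ge>0. \<forall>\<alpha>::real. \<alpha> > max \<beta> 0 \<longrightarrow> (\<forall>l::real.
    (let \<rho> = \<alpha> + \<beta> + 1 in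
      cmod (jacobi_fun \<alpha> \<beta> (\<i> * of_real \<rho> - of_real l) t
            - exp (\<i> * of_real l * of_real (ln (cosh t))))
        \<le> C * (\<bar>l\<bar> * min 1 t / \<alpha> powr (1 / 2))))"
  unfolding Let_def
proof (intro exI allI impI)
  fix t \<alpha> l :: real assume t: "t \<ge> 0" and \<alpha>: "\<alpha> > max \<beta> 0"
  then have \<alpha>': "\<alpha> > 0" "\<beta> < \<alpha>" by auto
  have \<beta>: "\<beta> \<ge> - 1/2" using assms by simp
  obtain h u where mj: "modulated_jacobi \<alpha> \<beta> l h u"
    and rep: "\<And>t. jacobi_fun \<alpha> \<beta> (\<i> * of_real (\<alpha> + \<beta> + 1) - of_real l) t
        = exp (\<i> * of_real l * of_real (ln (cosh t))) * h t"
    using jacobi_fun_modulated[OF \<alpha>'(1) \<beta>] by blast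
  interpret modulated_jacobi \<alpha> \<beta> l h u by (rule mj)
  define w where "w = exp (\<i> * of_real l * of_real (ln (cosh t)))"
  have w: "norm w = 1" by (simp add: w_def norm_exp_eq_Re)
  have "cmod (jacobi_fun \<alpha> \<beta> (\<i> * of_real (\<alpha> + \<beta> + 1) - of_real l) t - w) = norm (w * (h t - 1))"
    unfolding rep w_def by (simp add: right_diff_distrib)
  also have "\<dots> = norm (h t - 1)" by (simp add: norm_mult w)
  also have "\<dots> \<le> 2 * exp (\<bar>\<beta>\<bar> / 2) * (1 + 2 * \<bar>\<beta>\<bar>) * (\<bar>l\<bar> * min 1 t / sqrt \<alpha>)"
    by (rule deviation_estimate[OF \<alpha>'(2) t])
  also have "sqrt \<alpha> = \<alpha> powr (1 / 2)" using \<alpha>' by (simp add: powr_half_sqrt)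
  finally show "cmod (jacobi_fun \<alpha> \<beta> (\<i> * of_real (\<alpha> + \<beta> + 1) - of_real l) t
      - exp (\<i> * of_real l * of_real (ln (cosh t))))
      \<le> 2 * exp (\<bar>\<beta>\<bar> / 2) * (1 + 2 * \<bar>\<beta>\<bar>) * (\<bar>l\<bar> * min 1 t / \<alpha> powr (1 / 2))"
    unfolding w_def .
qed

end
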